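(* For every pair of finite simple graphs $G,H$, the complexes $\mathsf{B}(G*H)$ and $\operatorname{susp}(\mathsf{B}(G)*\mathsf{B}(H))$ are homotopy equivalent.
   Context: The join $G*H$ of graphs is obtained from disjoint copies of $G$ and $H$ by adding all edges between a vertex of $G$ and a vertex of $H$. The join $\mathsf{K}*\mathsf{L}$ of simplicial complexes has vertex set $V(\mathsf{K})\uplus V(\mathsf{L})$ and simplices $A\uplus B$ with $A\in\mathsf{K}$, $B\in\mathsf{L}$; $\operatorname{susp}(\mathsf{K})=\mathsf{K}*S^0$ is the suspension. For a graph $G$ and $A\subseteq V(G)$, $\operatorname{CN}(A)$ is the set of vertices adjacent to all vertices of $A$ (so $\operatorname{CN}(\varnothing)=V(G)$). $\mathsf{B}(G)$ is the simplicial complex on $\{+v,-v : v\in V(G)\}$ whose simplices are $\{+v: v\in A'\}\cup\{-v: v\in A''\}$ with $A',A''\subseteq V(G)$ disjoint, every vertex of $A'$ adjacent to every vertex of $A''$, and $\operatorname{CN}(A')\ne\varnothing$, $\operatorname{CN}(A'')\ne\varnothing$. *)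

theory Defs
  imports "HOL-Analysis.Analysis" "Graph_Theory.Pair_Digraph"
begin

text \<open>Finite simple graphs are the \<^locale>\<open>pair_graph\<close>s of the AFP: finite, loopless and with
  a symmetric arc relation, so that an edge is represented by its two arcs.\<close>

definition graph_join ::
    "'a pair_pre_digraph \<Rightarrow> 'b pair_pre_digraph \<Rightarrow> ('a + 'b) pair_pre_digraph" where
  "graph_join G H =
    \<lparr> pverts = pverts G <+> pverts H,
      parcs = {(Inl u, Inl v) | u v. (u, v) \<in> parcs G}
            \<union> {(Inr u, Inr v) | u v. (u, v) \<in> parcs H}
            \<union> {(Inl u, Inr v) | u v. u \<in> pverts G \<and> v \<in> pverts H}
            \<union> {(Inr v, Inl u) | u v. u \<in> pverts G \<and> v \<in> pverts H} \<rparr>"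

definition common_nbrs :: "'a pair_pre_digraph \<Rightarrow> 'a set \<Rightarrow> 'a set" where
  "common_nbrs G A = {w \<in> pverts G. \<forall>v\<in>A. (v, w) \<in> parcs G}"

text \<open>An abstract simplicial complex is given by its set of simplices, the empty simplex included;
  its vertices are the points of its singleton simplices. The disjoint union of simplices
  is \<^term>\<open>A <+> B\<close>.\<close>

definition complex_join :: "'u set set \<Rightarrow> 'v set set \<Rightarrow> ('u + 'v) set set" where
  "complex_join K L = {A <+> B | A B. A \<in> K \<and> B \<in> L}"

definition sphere0 :: "bool set set" where
  "sphere0 = {{}, {False}, {True}}"

definition susp :: "'u set set \<Rightarrow> ('u + bool) set set" where
  "susp K = complex_join K sphere0"

text \<open>The signed vertices \<open>+v\<close> and \<open>-v\<close> are encoded as \<^term>\<open>Inl v\<close> and \<^term>\<open>Inr v\<close>.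
  On a graph without vertices even the empty simplex is excluded, since then \<open>CN({}) = {}\<close>; graphs
  are therefore taken to have at least one vertex.\<close>

definition box_complex :: "'a pair_pre_digraph \<Rightarrow> ('a + 'a) set set" where
  "box_complex G =
    {Inl ` A' \<union> Inr ` A'' | A' A''.
       A' \<subseteq> pverts G \<and> A'' \<subseteq> pverts G \<and> A' \<inter> A'' = {} \<and>
       (\<forall>u\<in>A'. \<forall>v\<in>A''. (u, v) \<in> parcs G) \<and>
       common_nbrs G A' \<noteq> {} \<and> common_nbrs G A'' \<noteq> {}}"

text \<open>The geometric realization, as the set of barycentric coordinate functions whose support is a
  simplex. The function type carries the product topology; for a finite complex, as here, the
  induced topology is the usual (weak) topology of the realization.\<close>

definition realization :: "'v set set \<Rightarrow> ('v \<Rightarrow> real) set" where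
  "realization K = {x. (\<forall>v. 0 \<le> x v) \<and> {v. x v \<noteq> 0} \<in> K \<and> (\<Sum>v | x v \<noteq> 0. x v) = 1}"

end

theory Submission
  imports Defs
begin

text \<open>A simplex of \<open>B(G * H)\<close> is a pair of sets \<open>A', A''\<close>, each having a common neighbour in \<open>G\<close> or
  in \<open>H\<close>. Let \<open>X1\<close> consist of those simplices for which \<open>A' \<inter> V(H)\<close> has one in \<open>H\<close> and \<open>A'' \<inter> V(G)\<close>
  has one in \<open>G\<close>, and let \<open>X2\<close> be defined with the signs exchanged. If the trace of \<open>A'\<close> on a
  factor has no common neighbour there, then the trace of \<open>A''\<close> on this factor is empty; hence
  \<open>B(G * H) = X1 \<union> X2\<close>, while \<open>X1 \<inter> X2\<close> is \<open>B(G) * B(H)\<close>. Both halves are contractible: in \<open>X1\<close> one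
  moves mass to the positive vertices of \<open>G\<close> adjacent to all of \<open>A'' \<inter> V(G)\<close>, drops the negative
  vertices of \<open>G\<close>, and is then in a star of a positive vertex of \<open>G\<close>. A union of two contractible
  complexes is determined up to homotopy equivalence by their intersection, and the suspension of
  \<open>B(G) * B(H)\<close> is such a union, of two cones.\<close>

section \<open>Unions of two contractible spaces\<close>

definition homotopic_rel ::
    "'a::topological_space set \<Rightarrow> 'a set \<Rightarrow> 'b::topological_space set \<Rightarrow> ('a \<Rightarrow> 'b) \<Rightarrow> ('a \<Rightarrow> 'b) \<Rightarrow> bool" where
  "homotopic_rel A X Y f g \<longleftrightarrow> A \<subseteq> X \<and> homotopic_with_canon (\<lambda>k. \<forall>x\<in>A. k x = f x) X Y f g"

lemma homotopic_rel_iff: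
  "homotopic_rel A X Y f g \<longleftrightarrow> A \<subseteq> X \<and>
     (\<exists>h. continuous_on ({0..1::real} \<times> X) h \<and> h ` ({0..1} \<times> X) \<subseteq> Y \<and>
          (\<forall>x\<in>X. h (0, x) = f x) \<and> (\<forall>x\<in>X. h (1, x) = g x) \<and>
          (\<forall>t\<in>{0..1}. \<forall>x\<in>A. h (t, x) = f x))"
proof (cases "A \<subseteq> X")
  case True
  have "homotopic_with_canon (\<lambda>k. \<forall>x\<in>A. k x = f x) X Y f g \<longleftrightarrow>
      (\<exists>h. continuous_map (prod_topology (top_of_set {0..1::real}) (top_of_set X)) (top_of_set Y) h \<and>
        (\<forall>x\<in>topspace (top_of_set X). h (0, x) = f x) \<and>
        (\<forall>x\<in>topspace (top_of_set X). h (1, x) = g x) \<and>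
        (\<forall>t\<in>{0..1}. \<forall>x\<in>A. h (t, x) = f x))"
  proof (rule homotopic_with[where P = "\<lambda>k. \<forall>x\<in>A. k x = f x"], rule ball_cong)
    fix h k :: "'a \<Rightarrow> 'b" and x
    assume "\<And>x. x \<in> topspace (top_of_set X) \<Longrightarrow> h x = k x" and "x \<in> A"
    with True have "h x = k x" by auto
    then show "h x = f x \<longleftrightarrow> k x = f x" by simp
  qed simp
  then show ?thesis
    using True
    unfolding homotopic_rel_def prod_topology_subtopology_eu continuous_map_subtopology_eu
      image_subset_iff_funcset topspace_euclidean_subtopology conj_assoc
    by simp
qed (simp add: homotopic_rel_def)

lemma homotopic_relI:
  assumes "A \<subseteq> X" "continuous_on ({0..1::real} \<times> X) h" "\<And>t x. t \<in> {0..1} \<Longrightarrow> x \<in> X \<Longrightarrow> h (t, x) \<in> Y"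
    and "\<And>x. x \<in> X \<Longrightarrow> h (0, x) = f x" "\<And>x. x \<in> X \<Longrightarrow> h (1, x) = g x"
    and "\<And>t x. t \<in> {0..1} \<Longrightarrow> x \<in> A \<Longrightarrow> h (t, x) = f x"
  shows "homotopic_rel A X Y f g"
  unfolding homotopic_rel_iff
  using assms by (intro conjI exI[of _ h] ballI) (simp_all add: image_subset_iff subsetD)

lemma homotopic_relE:
  assumes "homotopic_rel A X Y f g"
  obtains h where "A \<subseteq> X" "continuous_on ({0..1::real} \<times> X) h"
    "\<forall>t\<in>{0..1}. \<forall>x\<in>X. h (t, x) \<in> Y" "\<forall>x\<in>X. h (0, x) = f x" "\<forall>x\<in>X. h (1, x) = g x"
    "\<forall>t\<in>{0..1}. \<forall>x\<in>A. h (t, x) = f x"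
  using assms unfolding homotopic_rel_iff image_subset_iff by auto

lemma homotopic_rel_agree:
  assumes "homotopic_rel A X Y f g" "x \<in> A"
  shows "g x = f x"
  using assms by (elim homotopic_relE) (metis atLeastAtMost_iff order.refl subsetD zero_le_one)

text \<open>The condition defining \<open>homotopic_rel\<close> mentions \<open>f\<close> alone, so
  reversal rests on \<open>homotopic_rel_agree\<close>: the last stage shows that \<open>g\<close>
  equals \<open>f\<close> on \<open>A\<close>.\<close>

lemma homotopic_rel_sym:
  assumes h: "homotopic_rel A X Y f g"
  shows "homotopic_rel A X Y g f"
proof -
  from h have "homotopic_with_canon (\<lambda>k. \<forall>x\<in>A. k x = f x) X Y g f"
    unfolding homotopic_rel_def by (blast intro: homotopic_with_symD)
  then show ?thesis
    using h homotopic_rel_agree[OF h] unfolding homotopic_rel_def by simp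
qed

lemma homotopic_rel_trans:
  assumes "homotopic_rel A X Y f g" "homotopic_rel A X Y g h"
  shows "homotopic_rel A X Y f h"
proof -
  have "homotopic_with_canon (\<lambda>k. \<forall>x\<in>A. k x = f x) X Y g h"
    using assms(2) homotopic_rel_agree[OF assms(1)] unfolding homotopic_rel_def by simp
  then show ?thesis
    using assms unfolding homotopic_rel_def by (blast intro: homotopic_with_trans)
qed

lemma homotopic_rel_imp_homotopic:
  "homotopic_rel A X Y f g \<Longrightarrow> homotopic_with_canon (\<lambda>_. True) X Y f g"
  unfolding homotopic_rel_def by (blast intro: homotopic_with_mono)

lemma homotopic_rel_comp_left:
  assumes "homotopic_rel A X Y f g" "continuous_on Y k" "k ` Y \<subseteq> Z"
  shows "homotopic_rel A X Z (k \<circ> f) (k \<circ> g)"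
proof -
  from assms(1) obtain h where h: "A \<subseteq> X" "continuous_on ({0..1::real} \<times> X) h"
    "\<forall>t\<in>{0..1}. \<forall>x\<in>X. h (t, x) \<in> Y"
    "\<forall>x\<in>X. h (0, x) = f x" "\<forall>x\<in>X. h (1, x) = g x"
    "\<forall>t\<in>{0..1}. \<forall>x\<in>A. h (t, x) = f x"
    by (rule homotopic_relE) (rule that; assumption)
  show ?thesis
  proof (rule homotopic_relI)
    show "continuous_on ({0..1::real} \<times> X) (\<lambda>p. k (h p))"
      by (rule continuous_on_compose2[OF assms(2) h(2)]) (use h(3) in auto)
  qed (use h assms in auto)
qed

text \<open>Both homotopies are stationary on \<open>A\<close>, which contains the overlap, so they
  agree there and can be pasted along the closed pieces.\<close>

lemma homotopic_rel_Un:
  assumes cl: "closedin (top_of_set (X1 \<union> X2)) X1" "closedin (top_of_set (X1 \<union> X2)) X2"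
    and A: "X1 \<inter> X2 \<subseteq> A"
    and h: "homotopic_rel A X1 Y f g" "homotopic_rel A X2 Y f g"
  shows "homotopic_rel A (X1 \<union> X2) Y f g"
proof -
  from h(1) obtain h1 where h1: "A \<subseteq> X1" "continuous_on ({0..1::real} \<times> X1) h1"
    "\<forall>t\<in>{0..1}. \<forall>x\<in>X1. h1 (t, x) \<in> Y"
    "\<forall>x\<in>X1. h1 (0, x) = f x" "\<forall>x\<in>X1. h1 (1, x) = g x"
    "\<forall>t\<in>{0..1}. \<forall>x\<in>A. h1 (t, x) = f x"
    by (rule homotopic_relE) (rule that; assumption)
  from h(2) obtain h2 where h2: "A \<subseteq> X2" "continuous_on ({0..1::real} \<times> X2) h2"
    "\<forall>t\<in>{0..1}. \<forall>x\<in>X2. h2 (t, x) \<in> Y"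
    "\<forall>x\<in>X2. h2 (0, x) = f x" "\<forall>x\<in>X2. h2 (1, x) = g x"
    "\<forall>t\<in>{0..1}. \<forall>x\<in>A. h2 (t, x) = f x"
    by (rule homotopic_relE) (rule that; assumption)
  let ?h = "\<lambda>p. if snd p \<in> X1 then h1 p else h2 p"
  have *: "({0..1} \<times> X1) \<union> ({0..1} \<times> X2) = {0..1::real} \<times> (X1 \<union> X2)" by auto
  have "continuous_on (({0..1} \<times> X1) \<union> ({0..1} \<times> X2)) ?h"
  proof (rule continuous_on_cases_local)
    show "closedin (top_of_set ({0..1} \<times> X1 \<union> {0..1} \<times> X2)) ({0..1::real} \<times> X1)"
      "closedin (top_of_set ({0..1} \<times> X1 \<union> {0..1} \<times> X2)) ({0..1::real} \<times> X2)"
      unfolding * by (intro closedin_Times cl closedin_subtopology_refl[THEN iffD2]; simp)+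
  qed (use h1 h2 A in auto)
  then show ?thesis
    unfolding * by (rule homotopic_relI[rotated]) (use h1 h2 A in auto)
qed

text \<open>A neighbourhood deformation retract pair in the weak sense that the retraction \<open>r\<close> is a
  self-map of \<open>X\<close> which lands in \<open>A\<close> near \<open>A\<close> only.\<close>

definition ndr_pair :: "'a::topological_space set \<Rightarrow> 'a set \<Rightarrow> bool" where
  "ndr_pair X A \<longleftrightarrow> (\<exists>(u :: 'a \<Rightarrow> real) r. continuous_on X u \<and> (\<forall>x\<in>X. 0 \<le> u x) \<and> (\<forall>x\<in>A. u x = 0) \<and>
     (\<forall>x\<in>X. u x \<le> 1 \<longrightarrow> r x \<in> A) \<and> homotopic_rel A X X id r)"

section \<open>Maps into contractible spaces\<close>

lemma contractible_homotopy:
  assumes "contractible Y"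
  obtains h c where "continuous_on ({0..1::real} \<times> Y) h"
    "\<And>t y. t \<in> {0..1} \<Longrightarrow> y \<in> Y \<Longrightarrow> h (t, y) \<in> Y"
    "\<And>y. y \<in> Y \<Longrightarrow> h (0, y) = y" "\<And>y. y \<in> Y \<Longrightarrow> h (1, y) = c"
proof -
  from assms obtain c where "homotopic_rel {} Y Y id (\<lambda>_. c)"
    unfolding contractible_def homotopic_rel_def by auto
  then obtain h where h: "continuous_on ({0..1::real} \<times> Y) h"
    "\<forall>t\<in>{0..1}. \<forall>y\<in>Y. h (t, y) \<in> Y" "\<forall>y\<in>Y. h (0, y) = id y" "\<forall>y\<in>Y. h (1, y) = c"
    by (rule homotopic_relE) (rule that; assumption)
  show ?thesis
    by (rule that[OF h(1)]) (use h in auto)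
qed

text \<open>Near \<open>A\<close> the map \<open>\<phi> \<circ> r\<close> is available; it is pushed
  along a contraction of \<open>Y\<close> for time \<open>u x\<close>. At \<open>u x = 1\<close> the
  value has become the constant \<open>c\<close>, which extends it to the rest of
  \<open>X\<close>.\<close>

lemma ndr_pair_extend:
  fixes \<phi> :: "'a::topological_space \<Rightarrow> 'b::topological_space"
  assumes ndr: "ndr_pair X A" and Y: "contractible Y" "Y \<noteq> {}"
    and \<phi>: "continuous_on A \<phi>" "\<phi> ` A \<subseteq> Y"
  obtains f where "continuous_on X f" "f ` X \<subseteq> Y" "\<And>x. x \<in> A \<Longrightarrow> f x = \<phi> x"
proof -
  from ndr obtain u :: "'a \<Rightarrow> real" and r where u: "continuous_on X u" "\<And>x. x \<in> X \<Longrightarrow> 0 \<le> u x" "\<And>x. x \<in> A \<Longrightarrow> u x = 0"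
    and r: "\<And>x. x \<in> X \<Longrightarrow> u x \<le> 1 \<Longrightarrow> r x \<in> A" and hr: "homotopic_rel A X X id r"
    unfolding ndr_pair_def by blast
  have rc: "continuous_on X r" "r ` X \<subseteq> X"
    using hr homotopic_with_imp_continuous[of _ X X id r] homotopic_with_imp_subset2[of _ X X id r]
    unfolding homotopic_rel_def by auto
  have rA: "r x = x" if "x \<in> A" for x
    using homotopic_rel_agree[OF hr that] by simp
  obtain h c where h: "continuous_on ({0..1::real} \<times> Y) h"
    "\<And>t y. t \<in> {0..1} \<Longrightarrow> y \<in> Y \<Longrightarrow> h (t, y) \<in> Y"
    "\<And>y. y \<in> Y \<Longrightarrow> h (0, y) = y" "\<And>y. y \<in> Y \<Longrightarrow> h (1, y) = c"
    using contractible_homotopy[OF Y(1)] by blast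
  have c: "c \<in> Y" using Y(2) h(2)[of 1] h(4) by force
  define f where "f x = (if u x \<le> 1 then h (u x, \<phi> (r x)) else c)" for x
  show ?thesis
  proof
    show "continuous_on X f" unfolding f_def
    proof (rule continuous_on_cases_le)
      have "continuous_on {x \<in> X. u x \<le> 1} (\<lambda>x. \<phi> (r x))"
        by (rule continuous_on_compose2[OF \<phi>(1) continuous_on_subset[OF rc(1)]]) (use r in auto)
      then show "continuous_on {x \<in> X. u x \<le> 1} (\<lambda>x. h (u x, \<phi> (r x)))"
        by (intro continuous_on_compose2[OF h(1)] continuous_intros continuous_on_subset[OF u(1)])
          (use r \<phi> u in auto)
    qed (use u h r \<phi> in \<open>auto simp: image_subset_iff\<close>)
    show "f ` X \<subseteq> Y" unfolding f_def using u r \<phi> h(2) c by (auto simp: image_subset_iff)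
    show "f x = \<phi> x" if "x \<in> A" for x
      unfolding f_def using u(3) rA h(3) that \<phi>(2) by auto
  qed
qed

text \<open>Both maps are deformed into maps \<open>k f0\<close> and \<open>k f1\<close> that depend
  only on the restriction to \<open>A\<close>: where \<open>u x \<le> 1\<close>, the point
  \<open>r x\<close> lies in \<open>A\<close>, and elsewhere the contraction of \<open>Y\<close> has
  reached its constant.\<close>

lemma ndr_pair_homotopic_rel:
  fixes f0 f1 :: "'a::topological_space \<Rightarrow> 'b::topological_space"
  assumes ndr: "ndr_pair X A" and Y: "contractible Y"
    and f0: "continuous_on X f0" "f0 ` X \<subseteq> Y" and f1: "continuous_on X f1" "f1 ` X \<subseteq> Y"
    and eq: "\<And>x. x \<in> A \<Longrightarrow> f0 x = f1 x"
  shows "homotopic_rel A X Y f0 f1"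
proof -
  from ndr obtain u :: "'a \<Rightarrow> real" and r where u: "continuous_on X u" "\<And>x. x \<in> X \<Longrightarrow> 0 \<le> u x" "\<And>x. x \<in> A \<Longrightarrow> u x = 0"
    and r: "\<And>x. x \<in> X \<Longrightarrow> u x \<le> 1 \<Longrightarrow> r x \<in> A" and hr: "homotopic_rel A X X id r"
    unfolding ndr_pair_def by blast
  have AX: "A \<subseteq> X" and rc: "continuous_on X r" "r ` X \<subseteq> X"
    using hr homotopic_with_imp_continuous[of _ X X id r] homotopic_with_imp_subset2[of _ X X id r]
    unfolding homotopic_rel_def by auto
  have rA: "r x = x" if "x \<in> A" for x
    using homotopic_rel_agree[OF hr that] by simp
  obtain h c where h: "continuous_on ({0..1::real} \<times> Y) h"
    "\<And>t y. t \<in> {0..1} \<Longrightarrow> y \<in> Y \<Longrightarrow> h (t, y) \<in> Y"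
    "\<And>y. y \<in> Y \<Longrightarrow> h (0, y) = y" "\<And>y. y \<in> Y \<Longrightarrow> h (1, y) = c"
    using contractible_homotopy[OF Y] by blast
  define k where "k f x = h (min 1 (u x), f (r x))" for f :: "'a \<Rightarrow> 'b" and x
  have *: "homotopic_rel A X Y f (k f)" if f: "continuous_on X f" "f ` X \<subseteq> Y" for f
  proof (rule homotopic_rel_trans)
    have fr: "f (r x) \<in> Y" if "x \<in> X" for x using f rc that by auto
    have fA: "f x \<in> Y" if "x \<in> A" for x using f AX that by auto
    show "homotopic_rel A X Y f (f \<circ> r)"
      using homotopic_rel_comp_left[OF hr f] by simp
    \<comment> \<open>The contraction is run up to a time proportional to
      \<open>min 1 (u x)\<close>. As \<open>u\<close> vanishes on \<open>A\<close>, nothing moves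
      there.\<close>
    show "homotopic_rel A X Y (f \<circ> r) (k f)"
    proof (rule homotopic_relI)
      let ?g = "\<lambda>p. (fst p * min 1 (u (snd p)), f (r (snd p)))"
      have "continuous_on ({0..1::real} \<times> X) (\<lambda>p. f (r (snd p)))"
        by (rule continuous_on_compose2[OF f(1)], rule continuous_on_compose2[OF rc(1)])
          (use rc in \<open>auto intro: continuous_intros\<close>)
      moreover have "continuous_on ({0..1::real} \<times> X) (\<lambda>p. u (snd p))"
        by (rule continuous_on_compose2[OF u(1)]) (auto intro: continuous_intros)
      ultimately show "continuous_on ({0..1::real} \<times> X) (h \<circ> ?g)"
        unfolding o_def
        by (intro continuous_on_compose2[OF h(1)] continuous_intros)
          (use u(2) f rc in \<open>auto simp: image_subset_iff intro!: mult_nonneg_nonneg mult_le_one\<close>)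
      show "(h \<circ> ?g) (t, x) \<in> Y" if "t \<in> {0..1}" "x \<in> X" for t x
        using that u(2)[of x] f rc
        by (auto simp: image_subset_iff intro!: h(2) mult_nonneg_nonneg mult_le_one)
    qed (use AX h(3) u(3) fr fA rA in \<open>auto simp: k_def subset_iff\<close>)
  qed
  have "k f0 x = k f1 x" if "x \<in> X" for x
  proof (cases "u x \<le> 1")
    case True
    then show ?thesis using eq r that by (simp add: k_def)
  next
    case False
    then show ?thesis using that f0 f1 rc h(4) by (auto simp: k_def image_subset_iff)
  qed
  then have "homotopic_rel A X Y f0 (k f1)"
    using *[OF f0] unfolding homotopic_rel_iff by auto
  then show ?thesis
    using *[OF f1] homotopic_rel_sym homotopic_rel_trans by blast
qed

text \<open>The homeomorphism of the intersections and its inverse extend half by half. Each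
  composite is the identity on the intersection, hence homotopic to the identity relative to it
  within each contractible half, and the two homotopies paste.\<close>

theorem homotopy_eqv_Un_contractible:
  fixes X1 X2 :: "'a::topological_space set" and Y1 Y2 :: "'b::topological_space set"
  assumes clX: "closedin (top_of_set (X1 \<union> X2)) X1" "closedin (top_of_set (X1 \<union> X2)) X2"
    and clY: "closedin (top_of_set (Y1 \<union> Y2)) Y1" "closedin (top_of_set (Y1 \<union> Y2)) Y2"
    and cX: "contractible X1" "contractible X2" "X1 \<noteq> {}" "X2 \<noteq> {}"
    and cY: "contractible Y1" "contractible Y2" "Y1 \<noteq> {}" "Y2 \<noteq> {}"
    and ndrX: "ndr_pair X1 (X1 \<inter> X2)" "ndr_pair X2 (X1 \<inter> X2)"
    and ndrY: "ndr_pair Y1 (Y1 \<inter> Y2)" "ndr_pair Y2 (Y1 \<inter> Y2)"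
    and hom: "(X1 \<inter> X2) homeomorphic (Y1 \<inter> Y2)"
  shows "(X1 \<union> X2) homotopy_eqv (Y1 \<union> Y2)"
proof -
  let ?A = "X1 \<inter> X2" and ?B = "Y1 \<inter> Y2"
  obtain \<phi> \<psi> where \<phi>: "continuous_on ?A \<phi>" "\<phi> ` ?A = ?B" and \<psi>: "continuous_on ?B \<psi>" "\<psi> ` ?B = ?A"
    and inv: "\<And>x. x \<in> ?A \<Longrightarrow> \<psi> (\<phi> x) = x" "\<And>y. y \<in> ?B \<Longrightarrow> \<phi> (\<psi> y) = y"
    using hom unfolding homeomorphic_def homeomorphism_def by metis
  have sub: "\<phi> ` ?A \<subseteq> Y1" "\<phi> ` ?A \<subseteq> Y2" "\<psi> ` ?B \<subseteq> X1" "\<psi> ` ?B \<subseteq> X2"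
    using \<phi> \<psi> by auto
  obtain f1 where f1: "continuous_on X1 f1" "f1 ` X1 \<subseteq> Y1" "\<And>x. x \<in> ?A \<Longrightarrow> f1 x = \<phi> x"
    using ndr_pair_extend[OF ndrX(1) cY(1,3) \<phi>(1) sub(1)] by blast
  obtain f2 where f2: "continuous_on X2 f2" "f2 ` X2 \<subseteq> Y2" "\<And>x. x \<in> ?A \<Longrightarrow> f2 x = \<phi> x"
    using ndr_pair_extend[OF ndrX(2) cY(2,4) \<phi>(1) sub(2)] by blast
  obtain g1 where g1: "continuous_on Y1 g1" "g1 ` Y1 \<subseteq> X1" "\<And>y. y \<in> ?B \<Longrightarrow> g1 y = \<psi> y"
    using ndr_pair_extend[OF ndrY(1) cX(1,3) \<psi>(1) sub(3)] by blast
  obtain g2 where g2: "continuous_on Y2 g2" "g2 ` Y2 \<subseteq> X2" "\<And>y. y \<in> ?B \<Longrightarrow> g2 y = \<psi> y"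
    using ndr_pair_extend[OF ndrY(2) cX(2,4) \<psi>(1) sub(4)] by blast
  define f where "f x = (if x \<in> X1 then f1 x else f2 x)" for x
  define g where "g y = (if y \<in> Y1 then g1 y else g2 y)" for y
  have fi: "f x = f1 x" if "x \<in> X1" for x using that by (simp add: f_def)
  have fi2: "f x = f2 x" if "x \<in> X2" for x using that f1 f2 by (simp add: f_def)
  have gi: "g x = g1 x" if "x \<in> Y1" for x using that by (simp add: g_def)
  have gi2: "g x = g2 x" if "x \<in> Y2" for x using that g1 g2 by (simp add: g_def)
  have fc1: "continuous_on X1 f" "f ` X1 \<subseteq> Y1" and fc2: "continuous_on X2 f" "f ` X2 \<subseteq> Y2"
    using f1 f2 fi fi2 by (simp_all add: image_subset_iff continuous_on_cong[OF refl fi] continuous_on_cong[OF refl fi2])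
  have gc1: "continuous_on Y1 g" "g ` Y1 \<subseteq> X1" and gc2: "continuous_on Y2 g" "g ` Y2 \<subseteq> X2"
    using g1 g2 gi gi2 by (simp_all add: image_subset_iff continuous_on_cong[OF refl gi] continuous_on_cong[OF refl gi2])
  have fA: "f x = \<phi> x" if "x \<in> ?A" for x using f1(3)[OF that] that fi by auto
  have gB: "g x = \<psi> x" if "x \<in> ?B" for x using g1(3)[OF that] that gi by auto
  have gf: "g (f x) = x" if "x \<in> ?A" for x
    using that fA[OF that] gB[of "\<phi> x"] \<phi>(2) inv(1) by auto
  have fg: "f (g x) = x" if "x \<in> ?B" for x
    using that gB[OF that] fA[of "\<psi> x"] \<psi>(2) inv(2) by auto
  have fc: "continuous_on (X1 \<union> X2) f" by (rule continuous_on_Un_local[OF clX fc1(1) fc2(1)])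
  have gc: "continuous_on (Y1 \<union> Y2) g" by (rule continuous_on_Un_local[OF clY gc1(1) gc2(1)])
  have comp: "continuous_on S (k \<circ> l)" "(k \<circ> l) ` S \<subseteq> S"
    if "continuous_on S l" "l ` S \<subseteq> T" "continuous_on T k" "k ` T \<subseteq> S"
    for S T k l
    using that continuous_on_compose[OF that(1) continuous_on_subset[OF that(3,2)]] by auto
  \<comment> \<open>A homotopy within one half is regarded as one in the union, the common target
    needed for pasting.\<close>
  have widen: "homotopic_rel C S T k l" if "homotopic_rel C S T' k l" "T' \<subseteq> T" for C S T T' k l
    using homotopic_rel_comp_left[OF that(1), of id] that(2) by (simp add: continuous_on_id')
  have "homotopic_rel ?A X1 (X1 \<union> X2) (g \<circ> f) id"
    using gf by (intro widen[OF ndr_pair_homotopic_rel[OF ndrX(1) cX(1) comp[OF fc1 gc1]]]) auto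
  moreover have "homotopic_rel ?A X2 (X1 \<union> X2) (g \<circ> f) id"
    using gf by (intro widen[OF ndr_pair_homotopic_rel[OF ndrX(2) cX(2) comp[OF fc2 gc2]]]) auto
  ultimately have X: "homotopic_rel ?A (X1 \<union> X2) (X1 \<union> X2) (g \<circ> f) id"
    by (intro homotopic_rel_Un[OF clX]) auto
  have "homotopic_rel ?B Y1 (Y1 \<union> Y2) (f \<circ> g) id"
    using fg by (intro widen[OF ndr_pair_homotopic_rel[OF ndrY(1) cY(1) comp[OF gc1 fc1]]]) auto
  moreover have "homotopic_rel ?B Y2 (Y1 \<union> Y2) (f \<circ> g) id"
    using fg by (intro widen[OF ndr_pair_homotopic_rel[OF ndrY(2) cY(2) comp[OF gc2 fc2]]]) auto
  ultimately have Y: "homotopic_rel ?B (Y1 \<union> Y2) (Y1 \<union> Y2) (f \<circ> g) id"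
    by (intro homotopic_rel_Un[OF clY]) auto
  show ?thesis
    unfolding homotopy_equivalent_space_def
  proof (intro exI conjI)
    show "continuous_map (top_of_set (X1 \<union> X2)) (top_of_set (Y1 \<union> Y2)) f"
      "continuous_map (top_of_set (Y1 \<union> Y2)) (top_of_set (X1 \<union> X2)) g"
      using fc gc fc1(2) fc2(2) gc1(2) gc2(2)
      unfolding continuous_map_subtopology_eu image_subset_iff_funcset[symmetric] by blast+
  qed (rule homotopic_rel_imp_homotopic[OF X] homotopic_rel_imp_homotopic[OF Y])+
qed

section \<open>Realizations of finite complexes\<close>

lemma realization_mono: "K \<subseteq> L \<Longrightarrow> realization K \<subseteq> realization L"
  by (auto simp: realization_def)

lemma realization_Un: "realization (K \<union> L) = realization K \<union> realization L"
  by (auto simp: realization_def)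

lemma realization_Int: "realization (K \<inter> L) = realization K \<inter> realization L"
  by (auto simp: realization_def)

section \<open>Complexes on a finite vertex set\<close>

abbreviation supp :: "('v \<Rightarrow> real) \<Rightarrow> 'v set" where
  "supp x \<equiv> {v. x v \<noteq> 0}"

definition complex_on :: "'v set \<Rightarrow> 'v set set \<Rightarrow> bool" where
  "complex_on V K \<longleftrightarrow> finite V \<and> K \<subseteq> Pow V \<and> {} \<in> K \<and> (\<forall>\<sigma>\<in>K. \<forall>\<tau>\<subseteq>\<sigma>. \<tau> \<in> K)"

lemma complex_onD:
  assumes "complex_on V K"
  shows "finite V" "\<sigma> \<in> K \<Longrightarrow> \<sigma> \<subseteq> V" "{} \<in> K" "\<sigma> \<in> K \<Longrightarrow> \<tau> \<subseteq> \<sigma> \<Longrightarrow> \<tau> \<in> K"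
  using assms unfolding complex_on_def by blast+

lemma complex_on_Int:
  assumes "complex_on U K" "complex_on U L"
  shows "complex_on U (K \<inter> L)"
  unfolding complex_on_def
proof (intro conjI ballI allI impI)
  show "finite U" by (rule complex_onD(1)[OF assms(1)])
  show "K \<inter> L \<subseteq> Pow U" using complex_onD(2)[OF assms(1)] by blast
  show "{} \<in> K \<inter> L" using complex_onD(3)[OF assms(1)] complex_onD(3)[OF assms(2)] by simp
  fix \<sigma> \<tau> assume "\<sigma> \<in> K \<inter> L" "\<tau> \<subseteq> \<sigma>"
  then show "\<tau> \<in> K \<inter> L"
    using complex_onD(4)[OF assms(1), of \<sigma> \<tau>] complex_onD(4)[OF assms(2), of \<sigma> \<tau>] by simp
qed

text \<open>The sum over the varying support becomes a sum over the fixed set \<open>V\<close>,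
  which is linear in the coordinates.\<close>

lemma realization_iff:
  assumes "complex_on V K"
  shows "x \<in> realization K \<longleftrightarrow> (\<forall>v. 0 \<le> x v) \<and> supp x \<in> K \<and> sum x V = 1"
proof (cases "supp x \<in> K")
  case True
  then have "sum x (supp x) = sum x V"
    using complex_onD[OF assms] by (intro sum.mono_neutral_left) auto
  then show ?thesis by (simp add: realization_def)
qed (simp add: realization_def)

text \<open>Deformations below are written as non-negative functions of arbitrary positive mass;
  dividing by the mass gives barycentric coordinates with the same support.\<close>

definition normalise :: "'v set \<Rightarrow> ('v \<Rightarrow> real) \<Rightarrow> 'v \<Rightarrow> real" where
  "normalise V y = (\<lambda>v. y v / sum y V)"

lemma sum_supp_pos:
  fixes y :: "'v \<Rightarrow> real"
  assumes "finite V" "\<And>v. 0 \<le> y v" "supp y \<subseteq> V" "supp y \<noteq> {}"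
  shows "0 < sum y V"
proof -
  obtain v where "v \<in> V" "y v \<noteq> 0" using assms by blast
  then show ?thesis using assms(1,2) by (intro sum_pos2[of _ v]) (auto simp: less_le)
qed

lemma normalise_supp:
  assumes "finite V" "\<And>v. 0 \<le> y v" "supp y \<subseteq> V" "supp y \<noteq> {}"
  shows "supp (normalise V y) = supp y"
  using sum_supp_pos[OF assms] by (auto simp: normalise_def)

lemma normalise_in_realization:
  assumes K: "complex_on V K" and y: "\<And>v. 0 \<le> y v" "supp y \<in> K" "supp y \<noteq> {}"
  shows "normalise V y \<in> realization K"
proof -
  have V: "finite V" "supp y \<subseteq> V" using complex_onD[OF K] y by auto
  note pos = sum_supp_pos[OF V(1) y(1) V(2) y(3)]
  then have "sum (normalise V y) V = 1"
    by (simp add: normalise_def flip: sum_divide_distrib)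
  then show ?thesis
    using pos y unfolding realization_iff[OF K] normalise_supp[OF V(1) y(1) V(2) y(3)]
    by (auto simp: normalise_def)
qed

lemma normalise_id: "sum x V = 1 \<Longrightarrow> normalise V x = x"
  by (simp add: normalise_def)

lemma continuous_on_normalise:
  assumes "\<And>v. continuous_on S (\<lambda>x. f x v)" "\<And>x. x \<in> S \<Longrightarrow> sum (f x) V \<noteq> 0"
  shows "continuous_on S (\<lambda>x. normalise V (f x))"
  unfolding normalise_def
  by (intro continuous_intros assms) (use assms in auto)

lemma continuous_on_coordinate:
  fixes f :: "'a::topological_space \<Rightarrow> 'v \<Rightarrow> real"
  shows "continuous_on S f \<Longrightarrow> continuous_on S (\<lambda>x. f x v)"
  by (rule continuous_on_product_then_coordinatewise)

text \<open>The straight-line homotopy works: every intermediate point has its support inside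
  \<open>supp (f x) \<union> supp (g x)\<close>.\<close>

lemma homotopic_rel_realization:
  fixes f g :: "'a::topological_space \<Rightarrow> 'v \<Rightarrow> real"
  assumes K: "complex_on V K" and A: "A \<subseteq> S"
    and f: "continuous_on S f" "f ` S \<subseteq> realization K"
    and g: "continuous_on S g" "g ` S \<subseteq> realization K"
    and fg: "\<And>x. x \<in> S \<Longrightarrow> supp (f x) \<union> supp (g x) \<in> K"
    and eq: "\<And>x. x \<in> A \<Longrightarrow> g x = f x"
  shows "homotopic_rel A S (realization K) f g"
proof (rule homotopic_relI[OF A])
  define h :: "real \<times> 'a \<Rightarrow> 'v \<Rightarrow> real"
    where "h = (\<lambda>p v. (1 - fst p) * f (snd p) v + fst p * g (snd p) v)"
  have "continuous_on ({0..1} \<times> S) (\<lambda>p. f (snd p) v)" "continuous_on ({0..1} \<times> S) (\<lambda>p. g (snd p) v)"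
    for v
    using f(1) g(1)
    by (auto intro!: continuous_on_coordinate elim!: continuous_on_compose2 intro: continuous_intros)
  then show "continuous_on ({0..1} \<times> S) h"
    unfolding h_def by (intro continuous_intros)
  show "h (t, x) \<in> realization K" if t: "t \<in> {0..1}" and x: "x \<in> S" for t x
    unfolding realization_iff[OF K]
  proof (intro conjI allI)
    have fx: "\<And>v. 0 \<le> f x v" "sum (f x) V = 1" and gx: "\<And>v. 0 \<le> g x v" "sum (g x) V = 1"
      using f(2) g(2) x realization_iff[OF K] by blast+
    show "0 \<le> h (t, x) v" for v using t fx(1) gx(1) by (simp add: h_def)
    show "sum (h (t, x)) V = 1"
      using fx(2) gx(2) by (simp add: h_def sum.distrib flip: sum_distrib_left)
    have "supp (h (t, x)) \<subseteq> supp (f x) \<union> supp (g x)" by (auto simp: h_def)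
    then show "supp (h (t, x)) \<in> K" using complex_onD(4)[OF K fg[OF x]] by blast
  qed
  show "h (0, x) = f x" "h (1, x) = g x" for x by (simp_all add: h_def)
  show "h (t, x) = f x" if "x \<in> A" for t x
    using eq[OF that] by (simp add: h_def algebra_simps)
qed

text \<open>A point of \<open>realization (Pow V)\<close> lies in \<open>realization L\<close>
  exactly when every non-simplex contains a vertex at which the point vanishes. These are finitely
  many closed conditions.\<close>

lemma closedin_realization:
  assumes L: "complex_on V L" and S: "realization L \<subseteq> S" "S \<subseteq> realization (Pow V)"
  shows "closedin (top_of_set S) (realization L)"
proof -
  let ?C = "\<Inter>\<sigma>\<in>Pow V - L. \<Union>v\<in>\<sigma>. {x. x v = (0::real)}"
  have fin: "finite V" using complex_onD[OF L] by simp
  have "closed {x. x v = (0::real)}" for v :: 'a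
    by (intro closed_Collect_eq continuous_intros) simp_all
  then have "closed ?C"
    using fin by (intro closed_INT ballI closed_UN) (auto intro: finite_subset)
  moreover have "realization L = S \<inter> ?C"
  proof (intro equalityI subsetI IntI)
    fix x assume x: "x \<in> realization L"
    then show "x \<in> S" using S by auto
    show "x \<in> ?C"
    proof (intro INT_I)
      fix \<sigma> assume "\<sigma> \<in> Pow V - L"
      moreover have "supp x \<in> L" using x by (simp add: realization_def)
      ultimately have "\<not> \<sigma> \<subseteq> supp x" using complex_onD(4)[OF L] by blast
      then show "x \<in> (\<Union>v\<in>\<sigma>. {x. x v = 0})" by auto
    qed
  next
    fix x assume x: "x \<in> S \<inter> ?C"
    have "supp x \<in> L"
    proof (rule ccontr)
      assume "supp x \<notin> L"
      then have "supp x \<in> Pow V - L" using x S by (auto simp: realization_def)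
      with x have "x \<in> (\<Union>v\<in>supp x. {x. x v = 0})" by blast
      then show False by simp
    qed
    then show "x \<in> realization L" using x S by (auto simp: realization_def)
  qed
  ultimately show ?thesis unfolding closedin_closed by blast
qed

section \<open>Retraction onto a subcomplex\<close>

lemma continuous_on_Min:
  fixes f :: "'i \<Rightarrow> 'a::topological_space \<Rightarrow> real"
  assumes "finite I" "I \<noteq> {}" "\<And>i. i \<in> I \<Longrightarrow> continuous_on S (f i)"
  shows "continuous_on S (\<lambda>x. Min ((\<lambda>i. f i x) ` I))"
  using assms
proof (induction rule: finite_ne_induct)
  case (insert i I)
  then show ?case by (simp add: continuous_on_min)
qed simp

text \<open>Some value is at least the average, and the factor 2 makes the inequality strict. Hence
  cutting coordinates down by this amount leaves positive mass.\<close>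

lemma ex_gt_half_average:
  fixes x :: "'v \<Rightarrow> real"
  assumes "finite Q" "0 < sum x Q"
  shows "\<exists>v\<in>Q. sum x Q / (2 * card Q) < x v"
proof (rule ccontr)
  assume "\<not> ?thesis"
  then have "sum x Q \<le> (\<Sum>v\<in>Q. sum x Q / (2 * card Q))" by (intro sum_mono) (simp add: not_less)
  also have "\<dots> \<le> sum x Q / 2" using assms by (cases "card Q = 0") auto
  finally show False using assms by simp
qed

text \<open>The function \<open>s\<close> in the proof dominates the least coordinate of \<open>x\<close> on every non-simplex of \<open>L\<close>,
  so that \<open>{v. s x < x v}\<close> is always a simplex of \<open>L\<close>; truncating at \<open>1 / (2 * card V)\<close> keeps a
  coordinate positive, as the largest coordinate of \<open>x\<close> is at least \<open>1 / card V\<close>.\<close>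

lemma ndr_pair_realization:
  assumes K: "complex_on V K" and L: "complex_on V L" and "L \<subseteq> K"
  shows "ndr_pair (realization K) (realization L)"
proof -
  let ?n = "real (card V)"
  define s where "s x = (\<Sum>\<sigma>\<in>Pow V - L. Min (x ` \<sigma>))" for x :: "'a \<Rightarrow> real"
  define y where "y x = (\<lambda>v. max 0 (x v - min (s x) (1 / (2 * ?n))))" for x :: "'a \<Rightarrow> real"
  define r where "r x = normalise V (y x)" for x
  have fin: "finite V" using complex_onD[OF K] by simp
  have ne: "finite \<sigma>" "\<sigma> \<noteq> {}" if "\<sigma> \<in> Pow V - L" for \<sigma>
    using that fin complex_onD(3)[OF L] by (auto intro: finite_subset)
  have xK: "0 \<le> x v" "supp x \<in> K" "supp x \<subseteq> V" "sum x V = 1" if "x \<in> realization K" for x v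
    using that complex_onD(2)[OF K] unfolding realization_iff[OF K] by blast+
  have Min0: "0 \<le> Min (x ` \<sigma>)" if "x \<in> realization K" "\<sigma> \<in> Pow V - L" for x \<sigma>
    using ne[OF that(2)] xK(1)[OF that(1)] by simp
  have s0: "0 \<le> s x" if "x \<in> realization K" for x
    unfolding s_def using Min0[OF that] by (intro sum_nonneg) auto
  \<comment> \<open>The support of a point of \<open>realization L\<close> includes no non-simplex,
    so each minimum is attained at a zero coordinate.\<close>
  have sL: "s x = 0" if "x \<in> realization L" for x
    unfolding s_def
  proof (intro sum.neutral ballI)
    fix \<sigma> assume \<sigma>: "\<sigma> \<in> Pow V - L"
    have "supp x \<in> L" using that by (simp add: realization_def)
    then have "\<not> \<sigma> \<subseteq> supp x" using \<sigma> complex_onD(4)[OF L, of "supp x" \<sigma>] by blast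
    then obtain v where v: "v \<in> \<sigma>" "x v = 0" by blast
    have "Min (x ` \<sigma>) \<le> x v" using ne[OF \<sigma>] v(1) by (intro Min_le) simp_all
    moreover have "x \<in> realization K" using that \<open>L \<subseteq> K\<close> by (auto simp: realization_def)
    ultimately show "Min (x ` \<sigma>) = 0" using Min0[OF _ \<sigma>] v(2) by (simp add: antisym)
  qed
  have cs: "continuous_on (realization K) s"
    unfolding s_def using ne
    by (intro continuous_on_sum continuous_on_Min continuous_on_coordinate continuous_on_id)
  have y0: "0 \<le> y x v" for x v by (simp add: y_def)
  have ysub: "supp (y x) \<subseteq> supp x" if "x \<in> realization K" for x
    using s0[OF that] by (auto simp: y_def)
  have yK: "supp (y x) \<in> K" if "x \<in> realization K" for x
    using complex_onD(4)[OF K] xK(2) ysub that by blast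
  have yne: "supp (y x) \<noteq> {}" if x: "x \<in> realization K" for x
  proof -
    obtain v where "v \<in> V" "1 / (2 * ?n) < x v"
      using ex_gt_half_average[OF fin, of x] xK(4)[OF x] by auto
    then have "y x v \<noteq> 0" by (auto simp: y_def)
    then show ?thesis by blast
  qed
  have rK: "r x \<in> realization K" "supp (r x) = supp (y x)" "sum (y x) V \<noteq> 0"
    if "x \<in> realization K" for x
  proof -
    have V: "supp (y x) \<subseteq> V" using ysub[OF that] xK(3)[OF that] by (rule order.trans)
    show "r x \<in> realization K" "supp (r x) = supp (y x)"
      unfolding r_def
      by (rule normalise_in_realization[OF K y0 yK[OF that] yne[OF that]]
          normalise_supp[OF fin y0 V yne[OF that]])+
    show "sum (y x) V \<noteq> 0" using sum_supp_pos[OF fin y0 V yne[OF that]] by simp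
  qed
  have rL: "r x = x" if "x \<in> realization L" for x
  proof -
    have x: "x \<in> realization K" using that \<open>L \<subseteq> K\<close> by (auto simp: realization_def)
    then have "y x = x" unfolding y_def sL[OF that] using xK(1) by (auto simp: max_def)
    then show ?thesis using xK(4)[OF x] by (simp add: r_def normalise_id)
  qed
  \<comment> \<open>The bound makes the truncation in \<open>y\<close> inactive, so
    \<open>s x\<close> itself is subtracted. Were the support of \<open>y x\<close> a non-simplex of
    \<open>L\<close>, its minimum would be a summand of \<open>s x\<close> while exceeding
    \<open>s x\<close>.\<close>
  have near: "r x \<in> realization L" if x: "x \<in> realization K" and u: "2 * ?n * s x \<le> 1" for x
  proof -
    have "?n > 0" using xK(4)[OF x] fin by (cases "V = {}") auto
    then have "s x \<le> 1 / (2 * ?n)" using u by (simp add: field_simps)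
    then have gt: "s x < x v" if "v \<in> supp (y x)" for v
      using that by (auto simp: y_def max_def split: if_splits)
    have "supp (y x) \<in> L"
    proof (rule ccontr)
      assume "supp (y x) \<notin> L"
      then have \<sigma>: "supp (y x) \<in> Pow V - L" using ysub[OF x] xK(3)[OF x] by auto
      then have "Min (x ` supp (y x)) \<le> s x"
        unfolding s_def using Min0[OF x] fin by (intro member_le_sum) auto
      moreover have "s x < Min (x ` supp (y x))"
        using gt ne[OF \<sigma>] by simp
      ultimately show False by simp
    qed
    then show ?thesis unfolding r_def using normalise_in_realization[OF L y0 _ yne[OF x]] by blast
  qed
  have "homotopic_rel (realization L) (realization K) (realization K) id r"
  proof (rule homotopic_rel_realization[OF K])
    show "realization L \<subseteq> realization K" using \<open>L \<subseteq> K\<close> by (auto simp: realization_def)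
    show "continuous_on (realization K) r"
      unfolding r_def
    proof (rule continuous_on_normalise)
      show "continuous_on (realization K) (\<lambda>x. y x v)" for v
        unfolding y_def
        by (intro continuous_on_max continuous_on_min continuous_on_diff continuous_on_const cs
            continuous_on_coordinate continuous_on_id)
    qed (use rK(3) in auto)
    show "supp (id x) \<union> supp (r x) \<in> K" if "x \<in> realization K" for x
      using rK(2)[OF that] ysub[OF that] xK(2)[OF that] by (simp add: Un_absorb2)
  qed (use rK(1) rL in auto)
  then show ?thesis
    unfolding ndr_pair_def using s0 sL near
    by (intro exI[of _ "\<lambda>x. 2 * ?n * s x"] exI[of _ r] conjI continuous_on_mult continuous_on_const cs) auto
qed

text \<open>The common \<open>E\<close>-neighbours of \<open>supp x \<inter> Q\<close> do not depend continuously on \<open>x\<close>, as that set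
  shrinks when \<open>supp x\<close> grows. Hence the coordinates in \<open>Q\<close> are first cut down by \<open>\<epsilon>\<close>; a vertex \<open>w\<close> with
  \<open>\<rho> x w > 0\<close> has non-neighbours of weight below \<open>\<epsilon>\<close> only, so it is adjacent to all that is left. The
  homotopy then runs linearly through \<open>y1\<close>, \<open>y2\<close>, \<open>y3\<close>, \<open>y4\<close>, consecutive stages having a common
  simplex.\<close>

lemma contractible_realization:
  assumes K: "complex_on V K" and PQ: "P \<inter> Q = {}" "Q \<subseteq> V"
    and add: "\<And>\<sigma>. \<sigma> \<in> K \<Longrightarrow> \<sigma> \<union> {w \<in> P. \<forall>v\<in>\<sigma> \<inter> Q. E v w} \<in> K"
    and ex: "\<And>\<sigma>. \<sigma> \<in> K \<Longrightarrow> \<exists>w\<in>P. \<forall>v\<in>\<sigma> \<inter> Q. E v w"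
  shows "contractible (realization K)" "realization K \<noteq> {}"
proof -
  \<comment> \<open>Half the average over \<open>Q\<close>: if the whole support lies in
    \<open>Q\<close>, some coordinate exceeds \<open>\<epsilon> x\<close> and survives in
    \<open>y1\<close>.\<close>
  define \<epsilon> where "\<epsilon> x = sum x Q / (2 * card Q)" for x :: "'a \<Rightarrow> real"
  define \<rho> where "\<rho> x w = max 0 (\<epsilon> x - sum x {v \<in> Q. \<not> E v w})" for x :: "'a \<Rightarrow> real" and w
  define y1 where "y1 x = (\<lambda>v. if v \<in> Q then max 0 (x v - \<epsilon> x) else x v)" for x
  define y2 where "y2 x = (\<lambda>v. if v \<in> P then x v + \<rho> x v else y1 x v)" for x
  define y3 where "y3 x = (\<lambda>v. if v \<in> Q then 0 else y2 x v)" for x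
  obtain p where p: "p \<in> P" using ex[OF complex_onD(3)[OF K]] by auto
  define y4 where "y4 = (\<lambda>v. if v = p then 1 else 0 :: real)"
  let ?R = "realization K"
  have fin: "finite V" "finite Q" using complex_onD[OF K] PQ finite_subset by auto
  have down: "\<tau> \<in> K" if "\<sigma> \<in> K" "\<tau> \<subseteq> \<sigma>" for \<sigma> \<tau> using complex_onD(4)[OF K] that by blast
  \<comment> \<open>For the empty simplex the condition in \<open>add\<close> is void, so
    \<open>P\<close> itself is a simplex and any of its vertices can serve as end point.\<close>
  have "P \<in> K" using add[OF complex_onD(3)[OF K]] by simp
  then have pK: "{p} \<in> K" "p \<in> V" using p down complex_onD(2)[OF K] by auto
  have y4R: "y4 \<in> ?R"
    unfolding realization_iff[OF K] using pK fin by (auto simp: y4_def)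
  then show "?R \<noteq> {}" by auto
  have xK: "0 \<le> x v" "supp x \<in> K" "supp x \<subseteq> V" "supp x \<noteq> {}" if "x \<in> ?R" for x v
  proof -
    show "0 \<le> x v" "supp x \<in> K" and V: "supp x \<subseteq> V"
      using that complex_onD(2)[OF K] unfolding realization_iff[OF K] by blast+
    have "sum x V \<noteq> 0" using that unfolding realization_iff[OF K] by simp
    then show "supp x \<noteq> {}" by (auto dest: sum.not_neutral_contains_not_neutral)
  qed
  have eps: "0 \<le> \<epsilon> x" if "x \<in> ?R" for x using xK(1)[OF that] by (simp add: \<epsilon>_def sum_nonneg)
  have rho: "0 \<le> \<rho> x w" for x w by (simp add: \<rho>_def)
  have pos: "0 \<le> y1 x v" "0 \<le> y2 x v" "0 \<le> y3 x v" if "x \<in> ?R" for x v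
    using xK(1)[OF that] rho by (simp_all add: y1_def y2_def y3_def)
  have sumQ: "0 < sum x Q" if "x \<in> ?R" "supp x \<subseteq> Q" for x
    using sum_supp_pos[OF fin(2) xK(1)[OF that(1)] that(2) xK(4)[OF that(1)]] .
  have s1: "supp (y1 x) \<subseteq> supp x" if "x \<in> ?R" for x
    using eps[OF that] xK(1)[OF that] by (auto simp: y1_def max_def not_le split: if_splits)
  have s1K: "supp (y1 x) \<in> K" if "x \<in> ?R" for x using down s1 xK(2) that by blast
  have s1ne: "supp (y1 x) \<noteq> {}" if x: "x \<in> ?R" for x
  proof (cases "supp x \<subseteq> Q")
    case True
    then obtain v where "v \<in> Q" "\<epsilon> x < x v"
      using ex_gt_half_average[OF fin(2) sumQ[OF x]] unfolding \<epsilon>_def by auto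
    then have "y1 x v \<noteq> 0" by (simp add: y1_def)
    then show ?thesis by blast
  next
    case False
    then obtain v where "v \<notin> Q" "x v \<noteq> 0" by auto
    then have "y1 x v \<noteq> 0" by (simp add: y1_def)
    then show ?thesis by blast
  qed
  have s12: "supp (y1 x) \<subseteq> supp (y2 x)" if x: "x \<in> ?R" for x
  proof
    fix v assume v: "v \<in> supp (y1 x)"
    show "v \<in> supp (y2 x)"
    proof (cases "v \<in> P")
      case True
      then have "v \<notin> Q" using PQ(1) by blast
      then have "x v \<noteq> 0" using v by (simp add: y1_def)
      then have "0 < x v + \<rho> x v" using xK(1)[OF x, of v] rho[of x v] by linarith
      then show ?thesis using True by (simp add: y2_def)
    qed (use v in \<open>simp add: y2_def\<close>)
  qed
  have s2: "supp (y2 x) \<subseteq> supp (y1 x) \<union> {w \<in> P. \<forall>v\<in>supp (y1 x) \<inter> Q. E v w}" if x: "x \<in> ?R" for x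
  proof
    fix w assume w: "w \<in> supp (y2 x)"
    show "w \<in> supp (y1 x) \<union> {w \<in> P. \<forall>v\<in>supp (y1 x) \<inter> Q. E v w}"
    proof (cases "w \<in> P \<and> x w = 0")
      case True
      then have lt: "sum x {v \<in> Q. \<not> E v w} < \<epsilon> x" using w by (auto simp: y2_def \<rho>_def max_def split: if_splits)
      have "E v w" if v: "v \<in> supp (y1 x) \<inter> Q" for v
      proof (rule ccontr)
        assume "\<not> E v w"
        then have "x v \<le> sum x {v \<in> Q. \<not> E v w}"
          using v fin(2) xK(1)[OF x] by (intro member_le_sum) auto
        moreover have "\<epsilon> x < x v" using v by (auto simp: y1_def max_def split: if_splits)
        ultimately show False using lt by simp
      qed
      then show ?thesis using True by blast
    next
      case False
      then show ?thesis using w PQ(1) by (auto simp: y1_def y2_def split: if_splits)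
    qed
  qed
  have s2K: "supp (y2 x) \<in> K" if "x \<in> ?R" for x using down[OF add[OF s1K] s2] that by blast
  have s2ne: "supp (y2 x) \<noteq> {}" if "x \<in> ?R" for x using s12 s1ne that by blast
  have s3: "supp (y3 x) \<subseteq> supp (y2 x) - Q" for x by (auto simp: y3_def)
  \<comment> \<open>Removing \<open>Q\<close> could leave nothing only if the support of
    \<open>x\<close> lies in \<open>Q\<close>. Then a vertex \<open>w\<close> of \<open>P\<close>
    related by \<open>E\<close> to all of this support has
    \<open>\<rho> x w = \<epsilon> x > 0\<close>, so new mass has appeared on
    \<open>P\<close>.\<close>
  have s3ne: "supp (y3 x) \<noteq> {}" if x: "x \<in> ?R" for x
  proof (cases "supp x \<subseteq> Q")
    case True
    then have "Q \<noteq> {}" using xK(4)[OF x] by auto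
    then have "0 < \<epsilon> x" using sumQ[OF x True] fin(2) by (simp add: \<epsilon>_def card_gt_0_iff)
    moreover obtain w where w: "w \<in> P" "\<forall>v\<in>supp x \<inter> Q. E v w" using ex[OF xK(2)[OF x]] by blast
    moreover have "sum x {v \<in> Q. \<not> E v w} = 0" using w by (intro sum.neutral) auto
    ultimately have "0 < \<rho> x w" by (simp add: \<rho>_def)
    moreover have "w \<notin> Q" using w PQ by auto
    ultimately have "y3 x w \<noteq> 0" using w xK(1)[OF x, of w] by (auto simp: y3_def y2_def)
    then show ?thesis by blast
  next
    case False
    then obtain v where "v \<notin> Q" "x v \<noteq> 0" by auto
    then have "y3 x v \<noteq> 0" using xK(1)[OF x, of v] rho[of x v] by (auto simp: y1_def y2_def y3_def)
    then show ?thesis by blast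
  qed
  have s3K: "supp (y3 x) \<in> K" if "x \<in> ?R" for x using down[OF s2K[OF that], of "supp (y3 x)"] s3[of x] by auto
  \<comment> \<open>Without vertices in \<open>Q\<close> the condition in \<open>add\<close> is void
    again, so all of \<open>P\<close>, and in particular \<open>p\<close>, can be added.\<close>
  have s4K: "supp (y3 x) \<union> supp y4 \<in> K" if x: "x \<in> ?R" for x
  proof -
    have "supp (y3 x) \<union> {w \<in> P. \<forall>v\<in>supp (y3 x) \<inter> Q. E v w} \<in> K" using add[OF s3K[OF x]] .
    moreover have "supp (y3 x) \<inter> Q = {}" using s3[of x] by auto
    moreover have "supp y4 = {p}" by (auto simp: y4_def)
    ultimately show ?thesis using p by (elim down) auto
  qed
  have cx: "continuous_on ?R (\<lambda>x. x v)" for v by (intro continuous_on_coordinate continuous_on_id)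
  have ce: "continuous_on ?R \<epsilon>" unfolding \<epsilon>_def divide_inverse
    by (intro continuous_on_mult continuous_on_sum continuous_on_const cx)
  have cr: "continuous_on ?R (\<lambda>x. \<rho> x w)" for w unfolding \<rho>_def
    by (intro continuous_on_max continuous_on_diff continuous_on_sum continuous_on_const cx ce)
  have c1: "continuous_on ?R (\<lambda>x. y1 x v)" for v
    unfolding y1_def by (cases "v \<in> Q") (simp_all add: continuous_on_max continuous_on_diff cx ce)
  have c2: "continuous_on ?R (\<lambda>x. y2 x v)" for v
    unfolding y2_def by (cases "v \<in> P") (simp_all add: continuous_on_add cx cr c1)
  have c3: "continuous_on ?R (\<lambda>x. y3 x v)" for v
    unfolding y3_def by (cases "v \<in> Q") (simp_all add: c2)
  have good: "continuous_on ?R (\<lambda>x. normalise V (f x))" "(\<lambda>x. normalise V (f x)) ` ?R \<subseteq> ?R"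
    "\<And>x. x \<in> ?R \<Longrightarrow> supp (normalise V (f x)) = supp (f x)"
    if f: "\<And>v. continuous_on ?R (\<lambda>x. f x v)" "\<And>x v. x \<in> ?R \<Longrightarrow> 0 \<le> f x v"
      "\<And>x. x \<in> ?R \<Longrightarrow> supp (f x) \<in> K" "\<And>x. x \<in> ?R \<Longrightarrow> supp (f x) \<noteq> {}" for f
  proof -
    have V: "supp (f x) \<subseteq> V" if "x \<in> ?R" for x by (rule complex_onD(2)[OF K f(3)[OF that]])
    have "sum (f x) V \<noteq> 0" if "x \<in> ?R" for x
      using sum_supp_pos[OF fin(1) f(2)[OF that] V[OF that] f(4)[OF that]] by simp
    then show "continuous_on ?R (\<lambda>x. normalise V (f x))"
      by (intro continuous_on_normalise f(1))
    show "(\<lambda>x. normalise V (f x)) ` ?R \<subseteq> ?R"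
      by (intro image_subsetI normalise_in_realization[OF K] f(2-4))
    show "supp (normalise V (f x)) = supp (f x)" if x: "x \<in> ?R" for x
      by (rule normalise_supp[OF fin(1) f(2)[OF x] V[OF x] f(4)[OF x]])
  qed
  note g1 = good[of y1, OF c1 pos(1) s1K s1ne]
  note g2 = good[of y2, OF c2 pos(2) s2K s2ne]
  note g3 = good[of y3, OF c3 pos(3) s3K s3ne]
  note hom = homotopic_rel_realization[OF K empty_subsetI]
  \<comment> \<open>Passing from \<open>x\<close> to \<open>y1\<close> and from \<open>y2\<close> to
    \<open>y3\<close> shrinks the support, passing from \<open>y1\<close> to \<open>y2\<close>
    enlarges it; in each case the larger support is the required simplex.\<close>
  have u1: "supp x \<union> supp (y1 x) \<in> K" and u2: "supp (y1 x) \<union> supp (y2 x) \<in> K"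
    and u3: "supp (y2 x) \<union> supp (y3 x) \<in> K" if "x \<in> ?R" for x
    using xK(2)[OF that] s2K[OF that] s3[of x]
    by (simp_all add: Un_absorb1[OF s12[OF that]] Un_absorb2[OF s1[OF that]]
        Un_absorb2[OF order.trans[OF s3 Diff_subset]])
  have id: "continuous_on ?R id" "id ` ?R \<subseteq> ?R" and c4: "continuous_on ?R (\<lambda>_. y4)" "(\<lambda>_. y4) ` ?R \<subseteq> ?R"
    using y4R by (auto simp: continuous_on_id')
  have "homotopic_rel {} ?R ?R id (\<lambda>x. normalise V (y1 x))"
    by (rule hom[OF id g1(1,2)]) (simp_all add: g1(3) u1)
  moreover have "homotopic_rel {} ?R ?R (\<lambda>x. normalise V (y1 x)) (\<lambda>x. normalise V (y2 x))"
    by (rule hom[OF g1(1,2) g2(1,2)]) (simp_all add: g1(3) g2(3) u2)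
  moreover have "homotopic_rel {} ?R ?R (\<lambda>x. normalise V (y2 x)) (\<lambda>x. normalise V (y3 x))"
    by (rule hom[OF g2(1,2) g3(1,2)]) (simp_all add: g2(3) g3(3) u3)
  moreover have "homotopic_rel {} ?R ?R (\<lambda>x. normalise V (y3 x)) (\<lambda>_. y4)"
    by (rule hom[OF g3(1,2) c4]) (simp_all add: g3(3) s4K)
  ultimately have "homotopic_rel {} ?R ?R id (\<lambda>_. y4)"
    by (meson homotopic_rel_trans)
  then show "contractible ?R"
    unfolding contractible_def by (blast dest: homotopic_rel_imp_homotopic)
qed

text \<open>Coordinates outside \<open>range j\<close> are set to 0, so \<open>j\<close> may miss
  points of the target type. This compares complexes over different vertex types.\<close>

lemma realization_relabel:
  assumes "inj j"
  shows "realization K homeomorphic realization ((`) j ` K)"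
proof -
  define \<phi> where "\<phi> x = (\<lambda>w. if w \<in> range j then x (inv j w) else 0)" for x :: "'a \<Rightarrow> real"
  define \<psi> where "\<psi> y = (\<lambda>v. y (j v))" for y :: "'b \<Rightarrow> real"
  have \<psi>\<phi>: "\<psi> (\<phi> x) = x" for x using assms by (simp add: \<phi>_def \<psi>_def)
  have \<phi>R: "\<phi> x \<in> realization ((`) j ` K)" if "x \<in> realization K" for x
  proof -
    have s: "supp (\<phi> x) = j ` supp x" using assms by (auto simp: \<phi>_def dest: injD)
    have "sum (\<phi> x) (j ` supp x) = sum x (supp x)"
      using assms by (subst sum.reindex) (auto simp: \<phi>_def inj_on_def)
    then show ?thesis using that unfolding realization_def mem_Collect_eq s by (auto simp: \<phi>_def)
  qed
  have \<phi>\<psi>: "\<phi> (\<psi> y) = y \<and> \<psi> y \<in> realization K" if "y \<in> realization ((`) j ` K)" for y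
  proof -
    have "supp y \<in> (`) j ` K" using that by (simp add: realization_def)
    then obtain \<sigma> where \<sigma>: "\<sigma> \<in> K" "supp y = j ` \<sigma>" by (rule imageE)
    have s: "supp (\<psi> y) = \<sigma>"
    proof -
      have "supp (\<psi> y) = j -` supp y" by (auto simp: \<psi>_def)
      then show ?thesis using \<sigma>(2) assms by (simp add: inj_vimage_image_eq)
    qed
    have "sum (\<psi> y) \<sigma> = sum y (supp y)"
      unfolding \<sigma>(2) using assms by (subst sum.reindex) (auto simp: \<psi>_def inj_on_def)
    then have "\<psi> y \<in> realization K"
      using that \<sigma>(1) unfolding realization_def mem_Collect_eq s by (auto simp: \<psi>_def)
    moreover have "\<phi> (\<psi> y) = y"
    proof
      fix w
      show "\<phi> (\<psi> y) w = y w"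
      proof (cases "w \<in> range j")
        case False
        then have "w \<notin> supp y" using \<sigma>(2) by auto
        then show ?thesis using False by (simp add: \<phi>_def)
      qed (simp add: \<phi>_def \<psi>_def f_inv_into_f)
    qed
    ultimately show ?thesis by simp
  qed
  have "continuous_on S (\<lambda>x. \<phi> x w)" for S w
    unfolding \<phi>_def by (cases "w \<in> range j") (simp_all add: continuous_on_coordinate[OF continuous_on_id])
  then have "continuous_on S \<phi>" for S by (intro continuous_on_coordinatewise_then_product)
  moreover have "continuous_on S \<psi>" for S unfolding \<psi>_def
    by (intro continuous_on_coordinatewise_then_product continuous_on_coordinate[OF continuous_on_id])
  ultimately have "homeomorphism (realization K) (realization ((`) j ` K)) \<phi> \<psi>"
    using \<phi>R \<phi>\<psi> \<psi>\<phi> by (intro homeomorphismI) auto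
  then show ?thesis unfolding homeomorphic_def by blast
qed

text \<open>For finite complexes the closedness and deformation hypotheses of
  \<open>homotopy_eqv_Un_contractible\<close> hold automatically; what remains is contractibility of
  the pieces and the comparison of the intersections.\<close>

theorem homotopy_eqv_realization_Un:
  assumes K: "complex_on V K1" "complex_on V K2" and L: "complex_on W L1" "complex_on W L2"
    and cK: "contractible (realization K1)" "contractible (realization K2)"
      "realization K1 \<noteq> {}" "realization K2 \<noteq> {}"
    and cL: "contractible (realization L1)" "contractible (realization L2)"
      "realization L1 \<noteq> {}" "realization L2 \<noteq> {}"
    and hom: "realization (K1 \<inter> K2) homeomorphic realization (L1 \<inter> L2)"
  shows "realization (K1 \<union> K2) homotopy_eqv realization (L1 \<union> L2)"
proof -
  have closed: "closedin (top_of_set (realization M1 \<union> realization M2)) (realization M1)"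
    "closedin (top_of_set (realization M1 \<union> realization M2)) (realization M2)"
    if "complex_on U M1" "complex_on U M2" for U and M1 M2 :: "'u set set"
  proof -
    have "realization M1 \<union> realization M2 \<subseteq> realization (Pow U)"
      using that by (intro Un_least realization_mono) (simp_all add: complex_on_def)
    then show "closedin (top_of_set (realization M1 \<union> realization M2)) (realization M1)"
      "closedin (top_of_set (realization M1 \<union> realization M2)) (realization M2)"
      using that by (intro closedin_realization[of U]; simp)+
  qed
  have ndr: "ndr_pair (realization M1) (realization M1 \<inter> realization M2)"
    "ndr_pair (realization M2) (realization M1 \<inter> realization M2)"
    if "complex_on U M1" "complex_on U M2" for U and M1 M2 :: "'u set set"
  proof -
    have "complex_on U (M1 \<inter> M2)" by (rule complex_on_Int[OF that])
    then show "ndr_pair (realization M1) (realization M1 \<inter> realization M2)"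
      "ndr_pair (realization M2) (realization M1 \<inter> realization M2)"
      unfolding realization_Int[symmetric]
      by (rule ndr_pair_realization[OF that(1) _ Int_lower1] ndr_pair_realization[OF that(2) _ Int_lower2];
          assumption)+
  qed
  show ?thesis
    unfolding realization_Un
    by (rule homotopy_eqv_Un_contractible[OF closed[OF K] closed[OF L] cK cL ndr[OF K] ndr[OF L]
          hom[unfolded realization_Int]])
qed

section \<open>Joins, cones and the suspension\<close>

lemma Plus_vimage: "(Inl -` S) <+> (Inr -` S) = S"
proof (rule set_eqI)
  fix x show "x \<in> (Inl -` S) <+> (Inr -` S) \<longleftrightarrow> x \<in> S" by (cases x) auto
qed

lemma vimage_Plus [simp]: "Inl -` (A <+> B) = A" "Inr -` (A <+> B) = B"
  by auto

lemma Plus_eq_iff: "A <+> B = C <+> D \<longleftrightarrow> A = C \<and> B = D"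
  by (metis vimage_Plus)

lemma subset_PlusE:
  assumes "\<tau> \<subseteq> A <+> B"
  obtains C D where "\<tau> = C <+> D" "C \<subseteq> A" "D \<subseteq> B"
proof (rule that)
  show "\<tau> = (Inl -` \<tau>) <+> (Inr -` \<tau>)" by (simp only: Plus_vimage)
qed (use assms in auto)

lemma Plus_empty: "{} <+> {} = {}"
  by (simp add: Plus_def)

lemma complex_join_iff: "A <+> B \<in> complex_join K L \<longleftrightarrow> A \<in> K \<and> B \<in> L"
  unfolding complex_join_def by (auto simp: Plus_eq_iff)

lemma complex_joinE:
  assumes "\<sigma> \<in> complex_join K L"
  obtains A B where "\<sigma> = A <+> B" "A \<in> K" "B \<in> L"
  using assms unfolding complex_join_def by blast

lemma complex_on_join:
  assumes K: "complex_on V K" and L: "complex_on W L"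
  shows "complex_on (V <+> W) (complex_join K L)"
  unfolding complex_on_def
proof (intro conjI ballI allI impI)
  show "finite (V <+> W)" using complex_onD(1)[OF K] complex_onD(1)[OF L] by simp
  show "complex_join K L \<subseteq> Pow (V <+> W)"
    using complex_onD(2)[OF K] complex_onD(2)[OF L] by (auto elim!: complex_joinE)
  show "{} \<in> complex_join K L"
    using complex_onD(3)[OF K] complex_onD(3)[OF L] complex_join_iff[of "{}" "{}" K L]
    by (simp add: Plus_empty)
  fix \<sigma> \<tau> assume "\<sigma> \<in> complex_join K L" "\<tau> \<subseteq> \<sigma>"
  then obtain A B where "A \<in> K" "B \<in> L" "\<tau> \<subseteq> A <+> B" by (blast elim: complex_joinE)
  then show "\<tau> \<in> complex_join K L"
    using complex_onD(4)[OF K] complex_onD(4)[OF L] by (elim subset_PlusE) (simp add: complex_join_iff)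
qed

lemma complex_on_cone: "complex_on (UNIV :: bool set) {{}, {b}}"
  by (auto simp: complex_on_def)

text \<open>The apex \<open>Inr b\<close> may be added to every simplex, so
  \<open>contractible_realization\<close> applies with \<open>P\<close> the apex alone and
  \<open>Q\<close> empty.\<close>

lemma contractible_cone:
  fixes K :: "'v set set" and b :: bool
  assumes K: "complex_on V K"
  shows "contractible (realization (complex_join K {{}, {b}}))"
    "realization (complex_join K {{}, {b}}) \<noteq> {}"
proof -
  let ?C = "complex_join K {{}, {b}}"
  have "\<sigma> \<union> {w \<in> {Inr b}. \<forall>v\<in>\<sigma> \<inter> {}. True} \<in> ?C" if \<sigma>: "\<sigma> \<in> ?C" for \<sigma>
  proof -
    obtain A B where AB: "\<sigma> = A <+> B" "A \<in> K" "B \<in> {{}, {b}}" by (rule complex_joinE[OF \<sigma>])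
    then have "A <+> (B \<union> {b}) \<in> ?C" by (auto simp: complex_join_iff)
    moreover have "\<sigma> \<union> {w \<in> {Inr b}. \<forall>v\<in>\<sigma> \<inter> {}. True} = A <+> (B \<union> {b})" using AB(1) by auto
    ultimately show ?thesis by simp
  qed
  then show "contractible (realization ?C)" "realization ?C \<noteq> {}"
    by (intro contractible_realization[where P = "{Inr b}" and Q = "{}" and E = "\<lambda>_ _. True",
          OF complex_on_join[OF K complex_on_cone]]; simp)+
qed

lemma susp_eq_Un: "susp K = complex_join K {{}, {True}} \<union> complex_join K {{}, {False}}"
  unfolding susp_def sphere0_def complex_join_def by blast

text \<open>The intersection is a copy of \<open>K\<close> over the vertex type of the suspension;
  the factor \<open>{{}}\<close> records the change of type.\<close>

lemma cone_Int_cone: "complex_join K {{}, {True}} \<inter> complex_join K {{}, {False}} = complex_join K {{}}"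
  by (auto simp: complex_join_iff elim!: complex_joinE)

section \<open>Box complexes of joins\<close>

text \<open>The common form of a box complex and of its two halves, which differ only in the
  conditions on the positive and the negative side. As these are arbitrary predicates, intersections
  keep the form.\<close>

definition biclique_complex ::
    "'a pair_pre_digraph \<Rightarrow> ('a set \<Rightarrow> bool) \<Rightarrow> ('a set \<Rightarrow> bool) \<Rightarrow> ('a + 'a) set set" where
  "biclique_complex G \<Phi> \<Psi> = {A <+> B | A B. A \<subseteq> pverts G \<and> B \<subseteq> pverts G \<and>
     (\<forall>u\<in>A. \<forall>v\<in>B. (u, v) \<in> parcs G) \<and> \<Phi> A \<and> \<Psi> B}"

lemma biclique_complex_iff:
  "A <+> B \<in> biclique_complex G \<Phi> \<Psi> \<longleftrightarrow> A \<subseteq> pverts G \<and> B \<subseteq> pverts G \<and>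
     (\<forall>u\<in>A. \<forall>v\<in>B. (u, v) \<in> parcs G) \<and> \<Phi> A \<and> \<Psi> B"
  unfolding biclique_complex_def by (auto simp: Plus_eq_iff)

lemma biclique_complexE:
  assumes "\<sigma> \<in> biclique_complex G \<Phi> \<Psi>"
  obtains A B where "\<sigma> = A <+> B" "A \<subseteq> pverts G" "B \<subseteq> pverts G"
    "\<forall>u\<in>A. \<forall>v\<in>B. (u, v) \<in> parcs G" "\<Phi> A" "\<Psi> B"
  using assms unfolding biclique_complex_def by blast

lemma biclique_complex_Int:
  "biclique_complex G \<Phi> \<Psi> \<inter> biclique_complex G \<Phi>' \<Psi>' =
   biclique_complex G (\<lambda>A. \<Phi> A \<and> \<Phi>' A) (\<lambda>B. \<Psi> B \<and> \<Psi>' B)"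
proof (rule set_eqI)
  fix \<sigma> :: "('a + 'a) set"
  obtain A B where \<sigma>: "\<sigma> = A <+> B" using Plus_vimage[symmetric] by blast
  show "\<sigma> \<in> biclique_complex G \<Phi> \<Psi> \<inter> biclique_complex G \<Phi>' \<Psi>' \<longleftrightarrow>
      \<sigma> \<in> biclique_complex G (\<lambda>A. \<Phi> A \<and> \<Phi>' A) (\<lambda>B. \<Psi> B \<and> \<Psi>' B)"
    unfolding \<sigma> Int_iff biclique_complex_iff by blast
qed

lemma complex_on_biclique:
  assumes fin: "finite (pverts G)" and ne: "\<Phi> {}" "\<Psi> {}"
    and anti: "\<And>A B. A \<subseteq> B \<Longrightarrow> \<Phi> B \<Longrightarrow> \<Phi> A" "\<And>A B. A \<subseteq> B \<Longrightarrow> \<Psi> B \<Longrightarrow> \<Psi> A"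
  shows "complex_on (pverts G <+> pverts G) (biclique_complex G \<Phi> \<Psi>)"
  unfolding complex_on_def
proof (intro conjI ballI allI impI)
  show "finite (pverts G <+> pverts G)" using fin by simp
  show "biclique_complex G \<Phi> \<Psi> \<subseteq> Pow (pverts G <+> pverts G)"
    by (auto elim!: biclique_complexE)
  show "{} \<in> biclique_complex G \<Phi> \<Psi>"
    using ne biclique_complex_iff[of "{}" "{}" G \<Phi> \<Psi>] by (simp add: Plus_empty)
  fix \<sigma> \<tau> assume "\<sigma> \<in> biclique_complex G \<Phi> \<Psi>" and \<tau>: "\<tau> \<subseteq> \<sigma>"
  then obtain A B where AB: "\<sigma> = A <+> B" "A <+> B \<in> biclique_complex G \<Phi> \<Psi>"
    by (blast elim: biclique_complexE)
  then obtain C D where CD: "\<tau> = C <+> D" "C \<subseteq> A" "D \<subseteq> B" using \<tau> by (auto elim: subset_PlusE)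
  show "\<tau> \<in> biclique_complex G \<Phi> \<Psi>"
    using AB(2) CD(2,3) anti[of C A] anti(2)[of D B] unfolding CD(1) biclique_complex_iff by blast
qed

text \<open>Adding the common neighbours in \<open>S\<close> to the positive side is possible for every simplex since
  \<open>S\<close> is completely joined to the remaining vertices.\<close>

lemma contractible_biclique:
  assumes K: "complex_on (pverts J <+> pverts J) (biclique_complex J \<Phi> \<Psi>)"
    and S: "S \<subseteq> pverts J" "\<And>u v. u \<in> S \<Longrightarrow> v \<in> pverts J - S \<Longrightarrow> (u, v) \<in> parcs J"
    and \<Phi>: "\<And>A B. \<Phi> A \<Longrightarrow> B \<subseteq> S \<Longrightarrow> \<Phi> (A \<union> B)"
    and \<Psi>: "\<And>B. \<Psi> B \<Longrightarrow> \<exists>w\<in>S. \<forall>v\<in>B \<inter> S. (w, v) \<in> parcs J"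
  shows "contractible (realization (biclique_complex J \<Phi> \<Psi>))"
    "realization (biclique_complex J \<Phi> \<Psi>) \<noteq> {}"
proof -
  let ?K = "biclique_complex J \<Phi> \<Psi>" and ?P = "Inl ` S :: ('a + 'a) set" and ?Q = "Inr ` S :: ('a + 'a) set"
  \<comment> \<open>\<open>E\<close> is evaluated only at a negative vertex \<open>v\<close> and a
    positive vertex \<open>w\<close>, where the projections recover the underlying vertices of
    \<open>J\<close>.\<close>
  define E :: "'a + 'a \<Rightarrow> 'a + 'a \<Rightarrow> bool" where "E v w \<longleftrightarrow> (projl w, projr v) \<in> parcs J" for v w
  have 1: "?P \<inter> ?Q = {}" "?Q \<subseteq> pverts J <+> pverts J" using S(1) by auto
  have 2: "\<sigma> \<union> {w \<in> ?P. \<forall>v\<in>\<sigma> \<inter> ?Q. E v w} \<in> ?K" if \<sigma>: "\<sigma> \<in> ?K" for \<sigma>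
  proof -
    obtain A B where AB: "\<sigma> = A <+> B" "A \<subseteq> pverts J" "B \<subseteq> pverts J"
      "\<forall>u\<in>A. \<forall>v\<in>B. (u, v) \<in> parcs J" "\<Phi> A" "\<Psi> B"
      using \<sigma> by (rule biclique_complexE) (rule that)
    define N where "N = {w \<in> S. \<forall>v\<in>B \<inter> S. (w, v) \<in> parcs J}"
    have "(u, v) \<in> parcs J" if "u \<in> N" "v \<in> B" for u v
      using that S(2)[of u v] AB(3) unfolding N_def by blast
    moreover have "N \<subseteq> S" by (auto simp: N_def)
    ultimately have "(A \<union> N) <+> B \<in> ?K"
      unfolding biclique_complex_iff using AB(2-6) S(1) \<Phi> by blast
    moreover have "\<sigma> \<union> {w \<in> ?P. \<forall>v\<in>\<sigma> \<inter> ?Q. E v w} = (A \<union> N) <+> B"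
    proof -
      have "(A <+> B) \<inter> ?Q = Inr ` (B \<inter> S)" by auto
      then show ?thesis unfolding AB(1) N_def E_def by auto
    qed
    ultimately show ?thesis by simp
  qed
  have 3: "\<exists>w\<in>?P. \<forall>v\<in>\<sigma> \<inter> ?Q. E v w" if \<sigma>: "\<sigma> \<in> ?K" for \<sigma>
  proof -
    obtain A B where AB: "\<sigma> = A <+> B" "\<Psi> B" using \<sigma> by (rule biclique_complexE) (rule that)
    then obtain w where "w \<in> S" "\<forall>v\<in>B \<inter> S. (w, v) \<in> parcs J" using \<Psi> by blast
    then show ?thesis unfolding AB(1) E_def by (intro bexI[of _ "Inl w"]) auto
  qed
  show "contractible (realization ?K)" "realization ?K \<noteq> {}"
    by (rule contractible_realization[OF K 1 2 3]; assumption)+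
qed

section \<open>Common neighbours in graphs and their joins\<close>

lemma common_nbrs_anti: "A \<subseteq> B \<Longrightarrow> common_nbrs G B \<noteq> {} \<Longrightarrow> common_nbrs G A \<noteq> {}"
  unfolding common_nbrs_def by blast

lemma common_nbrs_empty [simp]: "common_nbrs G {} = pverts G"
  by (simp add: common_nbrs_def)

text \<open>A vertex on both sides would be adjacent to itself, so in the absence of loops
  completeness between the sides forces disjointness.\<close>

lemma box_complex_biclique:
  assumes "\<And>v. (v, v) \<notin> parcs G"
  shows "box_complex G = biclique_complex G (\<lambda>A. common_nbrs G A \<noteq> {}) (\<lambda>A. common_nbrs G A \<noteq> {})"
proof -
  have "A \<inter> B = {}" if "\<forall>u\<in>A. \<forall>v\<in>B. (u, v) \<in> parcs G" for A B using assms that by blast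
  then show ?thesis unfolding box_complex_def biclique_complex_def Plus_def by blast
qed

lemma pair_graph_no_loop: "pair_graph G \<Longrightarrow> (v, v) \<notin> parcs G"
  unfolding pair_graph_def pair_digraph_def
  using pair_loopfree_digraph.pair_no_loops[of G "(v, v)"] by auto

lemma pair_graph_finite: "pair_graph G \<Longrightarrow> finite (pverts G)"
  unfolding pair_graph_def pair_digraph_def by (simp add: pair_fin_digraph.pair_finite_verts)

lemma pair_graph_sym: "pair_graph G \<Longrightarrow> (u, v) \<in> parcs G \<Longrightarrow> (v, u) \<in> parcs G"
  unfolding pair_graph_def pair_pseudo_graph_def pair_sym_digraph_def pair_sym_digraph_axioms_def
  by (auto simp: symmetric_def dest: symD)

lemma complex_on_box:
  assumes "pair_graph G" "pverts G \<noteq> {}"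
  shows "complex_on (pverts G <+> pverts G) (box_complex G)"
  unfolding box_complex_biclique[OF pair_graph_no_loop[OF assms(1)]]
  by (rule complex_on_biclique; (rule common_nbrs_anti, assumption, assumption)?) (simp_all add: assms pair_graph_finite)

lemma pverts_graph_join [simp]: "pverts (graph_join G H) = pverts G <+> pverts H"
  by (simp add: graph_join_def)

lemma parcs_graph_join [simp]:
  "(Inl u, Inl v) \<in> parcs (graph_join G H) \<longleftrightarrow> (u, v) \<in> parcs G"
  "(Inr x, Inr y) \<in> parcs (graph_join G H) \<longleftrightarrow> (x, y) \<in> parcs H"
  "(Inl u, Inr y) \<in> parcs (graph_join G H) \<longleftrightarrow> u \<in> pverts G \<and> y \<in> pverts H"
  "(Inr x, Inl v) \<in> parcs (graph_join G H) \<longleftrightarrow> x \<in> pverts H \<and> v \<in> pverts G"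
  by (auto simp: graph_join_def)

lemma ball_Plus: "(\<forall>x\<in>A <+> B. P x) \<longleftrightarrow> (\<forall>x\<in>A. P (Inl x)) \<and> (\<forall>x\<in>B. P (Inr x))"
  by auto

text \<open>A vertex of one factor is adjacent to every vertex of the other, so each part of the set
  restricts the common neighbours only within its own factor.\<close>

lemma common_nbrs_graph_join:
  assumes "A \<subseteq> pverts G" "B \<subseteq> pverts H"
  shows "common_nbrs (graph_join G H) (A <+> B) = common_nbrs G A <+> common_nbrs H B"
proof (rule set_eqI)
  fix w show "w \<in> common_nbrs (graph_join G H) (A <+> B) \<longleftrightarrow> w \<in> common_nbrs G A <+> common_nbrs H B"
    using assms by (cases w) (auto simp: common_nbrs_def ball_Plus)
qed


lemma common_nbrs_graph_join_nonempty:
  assumes "A \<subseteq> pverts (graph_join G H)"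
  shows "common_nbrs (graph_join G H) A \<noteq> {} \<longleftrightarrow>
    common_nbrs G (Inl -` A) \<noteq> {} \<or> common_nbrs H (Inr -` A) \<noteq> {}"
proof -
  obtain B C where A: "A = B <+> C" "B \<subseteq> pverts G" "C \<subseteq> pverts H"
    using assms unfolding pverts_graph_join by (rule subset_PlusE) (rule that)
  show ?thesis
    unfolding A(1) common_nbrs_graph_join[OF A(2,3)] vimage_Plus by (auto simp: Plus_def)
qed

text \<open>Any vertex of \<open>A\<close> is a common neighbour of \<open>B\<close>; if
  \<open>A\<close> is empty, every vertex of \<open>G\<close> is one of \<open>A\<close>. In a join
  this excludes that both signs fail within the same factor.\<close>

lemma complete_imp_common_nbrs:
  assumes G: "pair_graph G" "pverts G \<noteq> {}" and A: "A \<subseteq> pverts G"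
    and AB: "\<And>u v. u \<in> A \<Longrightarrow> v \<in> B \<Longrightarrow> (u, v) \<in> parcs G"
  shows "common_nbrs G A \<noteq> {} \<or> common_nbrs G B \<noteq> {}"
proof (cases "A = {}")
  case False
  then obtain u where "u \<in> A" by blast
  then have "u \<in> common_nbrs G B"
    using A AB pair_graph_sym[OF G(1)] unfolding common_nbrs_def by blast
  then show ?thesis by blast
qed (use G(2) in simp)

text \<open>In a join, a set has a common neighbour as soon as it has one within one factor; the
  maps \<open>f\<close> and \<open>g\<close> select the factor that provides it for either sign.\<close>

definition half_box ::
    "('c set \<Rightarrow> 'a set) \<Rightarrow> 'a pair_pre_digraph \<Rightarrow> ('c set \<Rightarrow> 'b set) \<Rightarrow> 'b pair_pre_digraph \<Rightarrow>
     'c pair_pre_digraph \<Rightarrow> ('c + 'c) set set" where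
  "half_box f G g H J =
    biclique_complex J (\<lambda>A. common_nbrs G (f A) \<noteq> {}) (\<lambda>A. common_nbrs H (g A) \<noteq> {})"

text \<open>Each of the four traces, of \<open>A\<close> and \<open>B\<close> on \<open>G\<close>
  and \<open>H\<close>, may have a common neighbour in its own factor or not. The box condition asks
  for a success for each sign, and \<open>complete_imp_common_nbrs\<close> gives one in each factor.
  These four disjunctions are the edges of a 4-cycle, and a set meeting all of them contains two
  opposite corners, which is the condition of one of the halves.\<close>

lemma box_complex_graph_join:
  assumes G: "pair_graph G" "pverts G \<noteq> {}" and H: "pair_graph H" "pverts H \<noteq> {}"
  shows "box_complex (graph_join G H) =
    half_box ((-`) Inr) H ((-`) Inl) G (graph_join G H) \<union>
    half_box ((-`) Inl) G ((-`) Inr) H (graph_join G H)"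
proof -
  let ?J = "graph_join G H"
  have "(v, v) \<notin> parcs ?J" for v
    using pair_graph_no_loop[OF G(1)] pair_graph_no_loop[OF H(1)] by (cases v) simp_all
  note eq = box_complex_biclique[of ?J, OF this]
  have "A <+> B \<in> box_complex ?J \<longleftrightarrow>
      A <+> B \<in> half_box ((-`) Inr) H ((-`) Inl) G ?J \<union> half_box ((-`) Inl) G ((-`) Inr) H ?J" for A B
  proof (cases "A \<subseteq> pverts ?J \<and> B \<subseteq> pverts ?J \<and> (\<forall>u\<in>A. \<forall>v\<in>B. (u, v) \<in> parcs ?J)")
    case True
    then have AB: "A \<subseteq> pverts ?J" "B \<subseteq> pverts ?J" and c: "\<And>u v. u \<in> A \<Longrightarrow> v \<in> B \<Longrightarrow> (u, v) \<in> parcs ?J"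
      by auto
    have "common_nbrs G (Inl -` A) \<noteq> {} \<or> common_nbrs G (Inl -` B) \<noteq> {}"
    proof (rule complete_imp_common_nbrs[OF G])
      show "Inl -` A \<subseteq> pverts G" using AB(1) by auto
      show "(u, v) \<in> parcs G" if "u \<in> Inl -` A" "v \<in> Inl -` B" for u v
        using c[of "Inl u" "Inl v"] that by simp
    qed
    moreover have "common_nbrs H (Inr -` A) \<noteq> {} \<or> common_nbrs H (Inr -` B) \<noteq> {}"
    proof (rule complete_imp_common_nbrs[OF H])
      show "Inr -` A \<subseteq> pverts H" using AB(1) by auto
      show "(u, v) \<in> parcs H" if "u \<in> Inr -` A" "v \<in> Inr -` B" for u v
        using c[of "Inr u" "Inr v"] that by simp
    qed
    ultimately show ?thesis
      unfolding eq half_box_def Un_iff biclique_complex_iff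
        common_nbrs_graph_join_nonempty[OF AB(1)] common_nbrs_graph_join_nonempty[OF AB(2)]
      using True by argo
  next
    case False
    then show ?thesis unfolding eq half_box_def Un_iff biclique_complex_iff by argo
  qed
  then show ?thesis by (metis (no_types, lifting) Plus_vimage set_eqI)
qed

text \<open>In the first half, adding positive vertices of \<open>G\<close> leaves the trace on
  \<open>H\<close>, and with it the condition on the positive side, unchanged, while the condition
  on the negative side supplies the common neighbour in \<open>G\<close> that
  \<open>contractible_biclique\<close> asks for. The second half exchanges the factors.\<close>

lemma half_box_contractible:
  assumes G: "pair_graph G" "pverts G \<noteq> {}" and H: "pair_graph H" "pverts H \<noteq> {}"
  defines "J \<equiv> graph_join G H"
  shows "complex_on (pverts J <+> pverts J) (half_box ((-`) Inr) H ((-`) Inl) G J)" (is ?c1)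
    and "complex_on (pverts J <+> pverts J) (half_box ((-`) Inl) G ((-`) Inr) H J)" (is ?c2)
    and "contractible (realization (half_box ((-`) Inr) H ((-`) Inl) G J))"
    and "realization (half_box ((-`) Inr) H ((-`) Inl) G J) \<noteq> {}"
    and "contractible (realization (half_box ((-`) Inl) G ((-`) Inr) H J))"
    and "realization (half_box ((-`) Inl) G ((-`) Inr) H J) \<noteq> {}"
proof -
  have fin: "finite (pverts J)" unfolding J_def by (simp add: pair_graph_finite G H)
  have c: "complex_on (pverts J <+> pverts J) (half_box f F g F' J)"
    if "mono f" "mono g" "f {} = {}" "g {} = {}" "pverts F \<noteq> {}" "pverts F' \<noteq> {}"
    for f g and F :: "'f pair_pre_digraph" and F' :: "'g pair_pre_digraph"
    unfolding half_box_def
  proof (rule complex_on_biclique[OF fin])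
    show "common_nbrs F (f A) \<noteq> {}" if "A \<subseteq> B" "common_nbrs F (f B) \<noteq> {}" for A B
      using common_nbrs_anti[OF monoD[OF \<open>mono f\<close> that(1)] that(2)] .
    show "common_nbrs F' (g A) \<noteq> {}" if "A \<subseteq> B" "common_nbrs F' (g B) \<noteq> {}" for A B
      using common_nbrs_anti[OF monoD[OF \<open>mono g\<close> that(1)] that(2)] .
  qed (simp_all add: that)
  have m: "mono ((-`) f)" for f :: "'u \<Rightarrow> 'w" by (auto intro: monoI)
  show c1: ?c1 and c2: ?c2
    by (rule c[OF m m vimage_empty vimage_empty]; simp add: G H)+
  show "contractible (realization (half_box ((-`) Inr) H ((-`) Inl) G J))" "realization (half_box ((-`) Inr) H ((-`) Inl) G J) \<noteq> {}"
  proof -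
    have *: "Inl ` pverts G \<subseteq> pverts J"
      "\<And>u v. u \<in> Inl ` pverts G \<Longrightarrow> v \<in> pverts J - Inl ` pverts G \<Longrightarrow> (u, v) \<in> parcs J"
      unfolding J_def by auto
    have \<Phi>: "common_nbrs H (Inr -` (A \<union> B)) \<noteq> {}"
      if "common_nbrs H (Inr -` A) \<noteq> {}" "B \<subseteq> Inl ` pverts G" for A B
    proof -
      have "Inr -` (A \<union> B) = Inr -` A" using that(2) by auto
      then show ?thesis using that(1) by simp
    qed
    \<comment> \<open>Symmetry of \<open>G\<close> turns the arcs towards the common neighbour into
      arcs leaving it.\<close>
    have \<Psi>: "\<exists>w\<in>Inl ` pverts G. \<forall>v\<in>B \<inter> Inl ` pverts G. (w, v) \<in> parcs J"
      if "common_nbrs G (Inl -` B) \<noteq> {}" for B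
      using that pair_graph_sym[OF G(1)] unfolding common_nbrs_def J_def by fastforce
    show "contractible (realization (half_box ((-`) Inr) H ((-`) Inl) G J))" "realization (half_box ((-`) Inr) H ((-`) Inl) G J) \<noteq> {}"
      unfolding half_box_def by (rule contractible_biclique[OF c1[unfolded half_box_def], of "Inl ` pverts G"];
          (rule * \<Phi> \<Psi>; assumption))+
  qed
  show "contractible (realization (half_box ((-`) Inl) G ((-`) Inr) H J))" "realization (half_box ((-`) Inl) G ((-`) Inr) H J) \<noteq> {}"
  proof -
    have *: "Inr ` pverts H \<subseteq> pverts J"
      "\<And>u v. u \<in> Inr ` pverts H \<Longrightarrow> v \<in> pverts J - Inr ` pverts H \<Longrightarrow> (u, v) \<in> parcs J"
      unfolding J_def by auto
    have \<Phi>: "common_nbrs G (Inl -` (A \<union> B)) \<noteq> {}"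
      if "common_nbrs G (Inl -` A) \<noteq> {}" "B \<subseteq> Inr ` pverts H" for A B
    proof -
      have "Inl -` (A \<union> B) = Inl -` A" using that(2) by auto
      then show ?thesis using that(1) by simp
    qed
    have \<Psi>: "\<exists>w\<in>Inr ` pverts H. \<forall>v\<in>B \<inter> Inr ` pverts H. (w, v) \<in> parcs J"
      if "common_nbrs H (Inr -` B) \<noteq> {}" for B
      using that pair_graph_sym[OF H(1)] unfolding common_nbrs_def J_def by fastforce
    show "contractible (realization (half_box ((-`) Inl) G ((-`) Inr) H J))" "realization (half_box ((-`) Inl) G ((-`) Inr) H J) \<noteq> {}"
      unfolding half_box_def by (rule contractible_biclique[OF c2[unfolded half_box_def], of "Inr ` pverts H"];
          (rule * \<Phi> \<Psi>; assumption))+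
  qed
qed

text \<open>In the box complex of the join the sign is the outer tag and the factor the inner one;
  in the join of the box complexes it is the other way round. The outermost \<open>Inl\<close>
  leaves room for the two suspension points, which are never hit.\<close>

fun regroup :: "('a + 'b) + ('a + 'b) \<Rightarrow> (('a + 'a) + ('b + 'b)) + bool" where
  "regroup (Inl (Inl a)) = Inl (Inl (Inl a))"
| "regroup (Inl (Inr b)) = Inl (Inr (Inl b))"
| "regroup (Inr (Inl a)) = Inl (Inl (Inr a))"
| "regroup (Inr (Inr b)) = Inl (Inr (Inr b))"

lemma inj_regroup: "inj regroup"
proof (rule injI)
  fix x y :: "('a + 'b) + ('a + 'b)"
  show "regroup x = regroup y \<Longrightarrow> x = y"
    by (cases x rule: regroup.cases; cases y rule: regroup.cases) auto
qed

lemma regroup_image: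
  "regroup ` ((A <+> B) <+> (C <+> D)) = ((A <+> C) <+> (B <+> D)) <+> {}"
  unfolding Plus_def image_Un image_image by auto

text \<open>In the intersection every trace has a common neighbour in its own factor, and arcs
  between the factors are always present, so the conditions separate into one box condition for each
  factor.\<close>

lemma regroup_half_box_Int:
  assumes G: "pair_graph G" and H: "pair_graph H"
  shows "(`) regroup ` (half_box ((-`) Inr) H ((-`) Inl) G (graph_join G H) \<inter>
      half_box ((-`) Inl) G ((-`) Inr) H (graph_join G H)) =
    complex_join (complex_join (box_complex G) (box_complex H)) {{}}"
proof -
  let ?J = "graph_join G H"
  let ?K = "half_box ((-`) Inr) H ((-`) Inl) G ?J \<inter> half_box ((-`) Inl) G ((-`) Inr) H ?J"
  let ?L = "complex_join (complex_join (box_complex G) (box_complex H)) {{}}"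
  have *: "(A <+> B) <+> (C <+> D) \<in> ?K \<longleftrightarrow> A <+> C \<in> box_complex G \<and> B <+> D \<in> box_complex H" for A B C D
    unfolding half_box_def biclique_complex_Int biclique_complex_iff vimage_Plus
      box_complex_biclique[OF pair_graph_no_loop[OF G]] box_complex_biclique[OF pair_graph_no_loop[OF H]]
    by (auto simp: ball_Plus subset_iff)
  have "regroup ` \<sigma> \<in> ?L" if "\<sigma> \<in> ?K" for \<sigma>
  proof -
    \<comment> \<open>\<open>A\<close> and \<open>B\<close> are the positive vertices in
      \<open>G\<close> and \<open>H\<close>, \<open>C\<close> and \<open>D\<close> the negative
      ones.\<close>
    obtain A B C D where \<sigma>: "\<sigma> = (A <+> B) <+> (C <+> D)" by (metis Plus_vimage)
    show ?thesis using that unfolding \<sigma> * regroup_image complex_join_iff by simp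
  qed
  moreover have "\<tau> \<in> (`) regroup ` ?K" if \<tau>: "\<tau> \<in> ?L" for \<tau>
  proof -
    obtain \<tau>1 E where 1: "\<tau> = \<tau>1 <+> E" by (metis Plus_vimage)
    obtain A B C D where 2: "\<tau>1 = (A <+> C) <+> (B <+> D)" by (metis Plus_vimage)
    have "E = {}" and K: "(A <+> B) <+> (C <+> D) \<in> ?K"
      using \<tau> unfolding 1 2 complex_join_iff * by simp_all
    then have "\<tau> = regroup ` ((A <+> B) <+> (C <+> D))" unfolding 1 2 regroup_image by simp
    then show ?thesis using K by (rule image_eqI)
  qed
  ultimately show ?thesis by blast
qed

theorem theorem7p4:
  fixes G :: "'a pair_pre_digraph" and H :: "'b pair_pre_digraph"
  assumes "pair_graph G" and "pair_graph H"
    and "pverts G \<noteq> {}" and "pverts H \<noteq> {}"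
  shows "realization (box_complex (graph_join G H)) homotopy_eqv
         realization (susp (complex_join (box_complex G) (box_complex H)))"
proof -
  let ?M = "complex_join (box_complex G) (box_complex H)"
  note G = assms(1,3) and H = assms(2,4)
  note M = complex_on_join[OF complex_on_box[OF G] complex_on_box[OF H]]
  note half = half_box_contractible[OF G H]
  show ?thesis
    unfolding box_complex_graph_join[OF G H] susp_eq_Un
  proof (rule homotopy_eqv_realization_Un[OF half(1,2) complex_on_join[OF M complex_on_cone]
        complex_on_join[OF M complex_on_cone] half(3,5,4,6)
        contractible_cone(1)[OF M] contractible_cone(1)[OF M]
        contractible_cone(2)[OF M] contractible_cone(2)[OF M]])
    show "realization (half_box ((-`) Inr) H ((-`) Inl) G (graph_join G H) \<inter>
        half_box ((-`) Inl) G ((-`) Inr) H (graph_join G H)) homeomorphic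
      realization (complex_join ?M {{}, {True}} \<inter> complex_join ?M {{}, {False}})"
      \<comment> \<open>Rewriting from right to left exhibits the intersection of the two cones as a
        relabelled copy of the intersection of the two halves.\<close>
      unfolding cone_Int_cone regroup_half_box_Int[OF G(1) H(1), symmetric]
      by (rule realization_relabel[OF inj_regroup])
  qed
qed

end
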